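(* Let $\mathcal{H}$ be a unitarily invariant space of pluriharmonic functions on $\mathbb{B}_d$ whose reproducing kernel has non-negative real part and let $f \in \mathcal{H}$. Then there exists a Borel measurable function $f^* : \partial\mathbb{B}_d \to \mathbb{C}$ such that $(f_r)$ converges to $f^*$ in capacity as $r \nearrow 1$, i.e. for every $\varepsilon > 0$, $$\operatorname{cap}^*_{\mathcal{H}}\big(\{\zeta \in \partial\mathbb{B}_d : |f^*(\zeta) - f_r(\zeta)| \ge \varepsilon\}\big) \to 0 \quad \text{as } r \nearrow 1.$$ The function $f^*$ is uniquely determined by this property outside of a Borel set of outer $\mathcal{H}$-capacity zero. Moreover, there exists a sequence $(r_n)$ in $[0,1)$ tending to $1$ such that $(f_{r_n})$ converges to $f^*$ pointwise outside of a Borel set of outer $\mathcal{H}$-capacity zero.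
   Context: $\mathbb{B}_d$ is the open Euclidean unit ball of $\mathbb{C}^d$ ($d \ge 1$), with boundary sphere $\partial\mathbb{B}_d$. A unitarily invariant space of pluriharmonic functions on $\mathbb{B}_d$ is a reproducing kernel Hilbert space $\mathcal{H}$ of functions on $\mathbb{B}_d$ whose reproducing kernel has the form $$K(z,w) = \sum_{n=0}^\infty a_n \langle z,w\rangle^n + \sum_{n=1}^\infty a_{-n}\overline{\langle z,w\rangle}^n,$$ where $a_n \ge 0$ for all $n \in \mathbb{Z}$, $a_0 = 1$, and the series converges on $\mathbb{B}_d \times \mathbb{B}_d$. For $0 \le r < 1$, $f_r(z) = f(rz)$, regarded as a function on $\overline{\mathbb{B}_d}$. The $\mathcal{H}$-energy of a Borel probability measure $\mu$ on $\partial\mathbb{B}_d$ is $\mathcal{E}(\mu) = \sup_{0 \le r < 1} \int\int K(rz,rw)\, d\mu(w)\, d\mu(z) \in [0,\infty]$ (the double integrals are non-negative reals, increasing in $r$). For compact $F \subset \partial\mathbb{B}_d$, $\operatorname{cap}_{\mathcal{H}}(F) = \sup\{1/\mathcal{E}(\mu) : \mu$ a Borel probability measure supported on $F\}$ (with $1/\infty = 0$ and $\operatorname{cap}(\emptyset) = 0$). For arbitrary $E \subset \partial\mathbb{B}_d$, the inner capacity is $\operatorname{cap}_{\mathcal{H}}(E) = \sup\{\operatorname{cap}_{\mathcal{H}}(F) : F \subset E \text{ compact}\}$ and the outer capacity is $\operatorname{cap}^*_{\mathcal{H}}(E) = \inf\{\operatorname{cap}_{\mathcal{H}}(G) : G \supset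 E,\ G \text{ open in } \partial\mathbb{B}_d\}$. *)

theory Defs
  imports "HOL-Probability.Probability"
begin

definition hinner :: "complex ^ 'd \<Rightarrow> complex ^ 'd \<Rightarrow> complex" where
  "hinner z w = (\<Sum>i\<in>UNIV. z $ i * cnj (w $ i))"

(* A function on X is represented by its extension by zero to the whole type, so that the
   vector space operations on H are the pointwise ones and equality of elements of H is
   equality on X.  The values of K outside X \<times> X play no role. *)

definition kernel_section :: "'a set \<Rightarrow> ('a \<Rightarrow> 'a \<Rightarrow> complex) \<Rightarrow> 'a \<Rightarrow> 'a \<Rightarrow> complex" where
  "kernel_section X K w = (\<lambda>z. if z \<in> X then K z w else 0)"

definition ip_norm :: "(('a \<Rightarrow> complex) \<Rightarrow> ('a \<Rightarrow> complex) \<Rightarrow> complex) \<Rightarrow> ('a \<Rightarrow> complex) \<Rightarrow> real" where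
  "ip_norm ip f = sqrt (Re (ip f f))"

locale rkhs =
  fixes X :: "'a set"
    and H :: "('a \<Rightarrow> complex) set"
    and ip :: "('a \<Rightarrow> complex) \<Rightarrow> ('a \<Rightarrow> complex) \<Rightarrow> complex"
    and K :: "'a \<Rightarrow> 'a \<Rightarrow> complex"
  assumes zero_outside: "\<lbrakk>f \<in> H; x \<notin> X\<rbrakk> \<Longrightarrow> f x = 0"
    and zero_mem: "(\<lambda>_. 0) \<in> H"
    and add_mem: "\<lbrakk>f \<in> H; g \<in> H\<rbrakk> \<Longrightarrow> (\<lambda>x. f x + g x) \<in> H"
    and scale_mem: "f \<in> H \<Longrightarrow> (\<lambda>x. c * f x) \<in> H"
    and ip_add_left:
      "\<lbrakk>f \<in> H; g \<in> H; h \<in> H\<rbrakk> \<Longrightarrow> ip (\<lambda>x. f x + g x) h = ip f h + ip g h"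
    and ip_scale_left: "\<lbrakk>f \<in> H; g \<in> H\<rbrakk> \<Longrightarrow> ip (\<lambda>x. c * f x) g = c * ip f g"
    and ip_commute: "\<lbrakk>f \<in> H; g \<in> H\<rbrakk> \<Longrightarrow> ip g f = cnj (ip f g)"
    and ip_nonneg: "f \<in> H \<Longrightarrow> 0 \<le> Re (ip f f)"
    and ip_definite: "\<lbrakk>f \<in> H; ip f f = 0\<rbrakk> \<Longrightarrow> f = (\<lambda>_. 0)"
    and complete:
      "\<lbrakk>\<And>n :: nat. F n \<in> H;
        \<And>e :: real. 0 < e \<Longrightarrow> \<exists>N. \<forall>m\<ge>N. \<forall>n\<ge>N. ip_norm ip (\<lambda>x. F m x - F n x) < e\<rbrakk>
       \<Longrightarrow> \<exists>f\<in>H. (\<lambda>n. ip_norm ip (\<lambda>x. F n x - f x)) \<longlonglongrightarrow> 0"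
    and kernel_mem: "w \<in> X \<Longrightarrow> kernel_section X K w \<in> H"
    and reproducing: "\<lbrakk>f \<in> H; w \<in> X\<rbrakk> \<Longrightarrow> f w = ip f (kernel_section X K w)"

locale unitarily_invariant_space =
  rkhs "ball 0 1 :: (complex ^ 'd) set" H ip K
  for H :: "(complex ^ 'd \<Rightarrow> complex) set"
    and ip :: "(complex ^ 'd \<Rightarrow> complex) \<Rightarrow> (complex ^ 'd \<Rightarrow> complex) \<Rightarrow> complex"
    and K :: "complex ^ 'd \<Rightarrow> complex ^ 'd \<Rightarrow> complex" +
  assumes kernel_form:
    "\<exists>a :: int \<Rightarrow> real. (\<forall>n. 0 \<le> a n) \<and> a 0 = 1 \<and>
       (\<forall>z\<in>ball 0 1. \<forall>w\<in>ball 0 1.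
          summable (\<lambda>n. complex_of_real (a (int n)) * hinner z w ^ n) \<and>
          summable (\<lambda>n. complex_of_real (a (- int (Suc n))) * cnj (hinner z w) ^ Suc n) \<and>
          K z w = (\<Sum>n. complex_of_real (a (int n)) * hinner z w ^ n)
                + (\<Sum>n. complex_of_real (a (- int (Suc n))) * cnj (hinner z w) ^ Suc n))"

definition sphere_borel :: "(complex ^ 'd) measure" where
  "sphere_borel = restrict_space borel (sphere 0 1)"

definition sphere_probs :: "(complex ^ 'd) set \<Rightarrow> (complex ^ 'd) measure set" where
  "sphere_probs F =
     {\<mu>. prob_space \<mu> \<and> sets \<mu> = sets sphere_borel \<and> emeasure \<mu> (sphere 0 1 - F) = 0}"

(* The double integral is a non-negative real number because K is positive definite; Re only
   serves to change its type. *)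
definition energy ::
    "(complex ^ 'd \<Rightarrow> complex ^ 'd \<Rightarrow> complex) \<Rightarrow> (complex ^ 'd) measure \<Rightarrow> ennreal" where
  "energy K \<mu> =
     (SUP r\<in>{0..<1::real}. ennreal (Re (\<integral>z. (\<integral>w. K (r *\<^sub>R z) (r *\<^sub>R w) \<partial>\<mu>) \<partial>\<mu>)))"

(* In ennreal, 1 / \<infinity> = 0 and the supremum of the empty set is 0. *)
definition compact_cap ::
    "(complex ^ 'd \<Rightarrow> complex ^ 'd \<Rightarrow> complex) \<Rightarrow> (complex ^ 'd) set \<Rightarrow> ennreal" where
  "compact_cap K F = (SUP \<mu>\<in>sphere_probs F. 1 / energy K \<mu>)"

definition inner_cap ::
    "(complex ^ 'd \<Rightarrow> complex ^ 'd \<Rightarrow> complex) \<Rightarrow> (complex ^ 'd) set \<Rightarrow> ennreal" where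
  "inner_cap K E = (SUP F\<in>{F. compact F \<and> F \<subseteq> E}. compact_cap K F)"

definition outer_cap ::
    "(complex ^ 'd \<Rightarrow> complex ^ 'd \<Rightarrow> complex) \<Rightarrow> (complex ^ 'd) set \<Rightarrow> ennreal" where
  "outer_cap K E = (INF G\<in>{G. openin (top_of_set (sphere 0 1)) G \<and> E \<subseteq> G}. inner_cap K G)"

definition converges_in_cap ::
    "(complex ^ 'd \<Rightarrow> complex ^ 'd \<Rightarrow> complex) \<Rightarrow> (complex ^ 'd \<Rightarrow> complex)
       \<Rightarrow> (complex ^ 'd \<Rightarrow> complex) \<Rightarrow> bool" where
  "converges_in_cap K f fstar \<longleftrightarrow>
     (\<forall>\<epsilon>::real. 0 < \<epsilon> \<longrightarrow>
        ((\<lambda>r. outer_cap K {\<zeta> \<in> sphere 0 1. \<epsilon> \<le> cmod (fstar \<zeta> - f (r *\<^sub>R \<zeta>))})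
          \<longlongrightarrow> 0) (at_left (1::real)))"

end

theory Submission imports Defs begin

text \<open>Let \<open>\<mu>\<close> be a probability measure on the sphere. Since \<open>Re K \<ge> 0\<close>, the potential of \<open>h \<mu>\<close> with
  \<open>\<bar>h\<bar> \<le> 1\<close> has norm at most \<open>\<surd>(energy \<mu>)\<close>, so that \<open>\<integral>\<bar>f\<^sub>r\<bar> d\<mu> \<le> 2 \<parallel>f\<parallel> \<surd>(energy \<mu>)\<close> for
  every \<open>f \<in> H\<close> and \<open>r < 1\<close>. This is a weak-type capacitary inequality, uniform in \<open>r\<close>. Functions
  uniformly continuous on the ball are dense in \<open>H\<close> (they contain the kernel functions), hence
  \<open>(f\<^sub>r)\<close> is Cauchy in capacity. The square root of the outer capacity is countably subadditive,
  and the usual argument for convergence in measure applies.\<close>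

section \<open>Reproducing kernel Hilbert spaces\<close>

text \<open>An element of \<open>H\<close> has no given values on the sphere, so a dilate is always
  paired with the radial energy at the same radius; the supremum in the definition of the energy
  then makes the bounds uniform in the radius. The factor 2 in the integral bound comes from
  treating real and imaginary parts separately, since the admissible weights h are real. For open G
  the square root of the capacity is the supremum of \<mu>(G) / sqrt(E(\<mu>)) over probability
  measures \<mu> of finite energy E(\<mu>). A competitor for a compact subset of G has mass one on
  G. Conversely, the normalised restriction of \<mu> to a compact F is a competitor for F, and its
  energy is at most E(\<mu>) / \<mu>(F)^2 because Re K is non-negative. In this form countable
  subadditivity is that of each single \<mu>, which is why all sizes below are measured by \<delta>
  and squared only when capacities are compared. Outer capacity sees a set through its open
  neighbourhoods, while the limit function is merely Borel. The sets where it is far from a dilate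
  are therefore covered by level sets of differences of dilates, which are continuous.\<close>

context rkhs
begin

section \<open>Inner product identities and the Cauchy-Schwarz inequality\<close>

lemma diff_mem:
  assumes "f \<in> H" "g \<in> H"
  shows "(\<lambda>x. f x - g x) \<in> H"
  using add_mem[OF assms(1) scale_mem[OF assms(2), of "-1"]] by simp

lemma ip_add_right:
  assumes "f \<in> H" "g \<in> H" "h \<in> H"
  shows "ip h (\<lambda>x. f x + g x) = ip h f + ip h g"
  using ip_commute[OF add_mem[OF assms(1,2)] assms(3)] ip_add_left[OF assms]
    ip_commute[OF assms(1,3)] ip_commute[OF assms(2,3)] by simp

lemma ip_scale_right:
  assumes "f \<in> H" "g \<in> H"
  shows "ip g (\<lambda>x. c * f x) = cnj c * ip g f"
  using ip_commute[OF scale_mem[OF assms(1)] assms(2)] ip_scale_left[OF assms]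
    ip_commute[OF assms] by simp

lemma ip_diff_left:
  assumes "f \<in> H" "g \<in> H" "h \<in> H"
  shows "ip (\<lambda>x. f x - g x) h = ip f h - ip g h"
  using ip_add_left[OF assms(1) scale_mem[OF assms(2), of "-1"] assms(3)]
    ip_scale_left[OF assms(2,3), of "-1"] by simp

lemma ip_diff_right:
  assumes "f \<in> H" "g \<in> H" "h \<in> H"
  shows "ip h (\<lambda>x. f x - g x) = ip h f - ip h g"
  using ip_add_right[OF assms(1) scale_mem[OF assms(2), of "-1"] assms(3)]
    ip_scale_right[OF assms(2,3), of "-1"] by simp

lemma ip_norm_nonneg: "f \<in> H \<Longrightarrow> 0 \<le> ip_norm ip f"
  by (simp add: ip_norm_def ip_nonneg)

lemma ip_norm_square: "f \<in> H \<Longrightarrow> (ip_norm ip f)\<^sup>2 = Re (ip f f)"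
  by (simp add: ip_norm_def ip_nonneg)

lemma ip_self: "f \<in> H \<Longrightarrow> ip f f = of_real ((ip_norm ip f)\<^sup>2)"
  using ip_commute[of f f] by (simp add: ip_norm_square complex_eq_iff)

lemma ip_norm_minus_commute:
  assumes "f \<in> H" "g \<in> H"
  shows "ip_norm ip (\<lambda>x. f x - g x) = ip_norm ip (\<lambda>x. g x - f x)"
  by (simp add: ip_norm_def ip_diff_left[OF _ _ diff_mem] ip_diff_right assms)

lemma ip_zero_right:
  assumes "f \<in> H"
  shows "ip f (\<lambda>_. 0) = 0"
  using ip_scale_right[OF zero_mem assms, of 0] by simp

lemma Cauchy_Schwarz:
  assumes f: "f \<in> H" and g: "g \<in> H"
  shows "cmod (ip f g) \<le> ip_norm ip f * ip_norm ip g"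
proof (cases "ip g g = 0")
  case True
  then have "g = (\<lambda>_. 0)"
    using ip_definite g by blast
  then show ?thesis
    using ip_zero_right[OF f] ip_norm_nonneg[OF f] ip_norm_nonneg[OF g] by simp
next
  case False
  define N where "N = (ip_norm ip g)\<^sup>2"
  have gg: "ip g g = of_real N"
    using ip_self[OF g] by (simp add: N_def)
  have N: "N > 0"
    using False gg by (simp add: N_def)
  define c where "c = ip f g / of_real N"
  have cg: "(\<lambda>x. c * g x) \<in> H"
    using scale_mem g by blast
  have gf: "ip g f = cnj (ip f g)"
    using ip_commute[OF f g] .
  have "0 \<le> Re (ip (\<lambda>x. f x - c * g x) (\<lambda>x. f x - c * g x))"
    using ip_nonneg diff_mem[OF f cg] by blast
  also have "ip (\<lambda>x. f x - c * g x) (\<lambda>x. f x - c * g x)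
      = ip f f - cnj c * ip f g - c * ip g f + c * cnj c * ip g g"
    by (simp add: ip_diff_left[OF f cg diff_mem[OF f cg]] ip_diff_right[OF f cg] f cg
        ip_scale_left[OF g cg] ip_scale_left[OF g f] ip_scale_right[OF g f]
        ip_scale_right[OF g g] algebra_simps)
  also have "\<dots> = of_real ((ip_norm ip f)\<^sup>2 - (cmod (ip f g))\<^sup>2 / N)"
    using N complex_norm_square[of "ip f g", symmetric]
    by (simp add: ip_self[OF f] gg gf c_def field_simps power2_eq_square)
  finally have "(cmod (ip f g))\<^sup>2 / N \<le> (ip_norm ip f)\<^sup>2"
    by simp
  then have "(cmod (ip f g))\<^sup>2 \<le> (ip_norm ip f * ip_norm ip g)\<^sup>2"
    using N by (simp add: field_simps N_def power_mult_distrib)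
  then show ?thesis
    using ip_norm_nonneg f g by (auto intro: power2_le_imp_le)
qed

text \<open>Minimise \<open>\<parallel>u\<parallel>\<^sup>2 - 2 Re (L u)\<close> over the (not necessarily closed) subspace \<open>V\<close>. For
  \<open>V = H\<close> the limit represents \<open>L\<close>; for \<open>L u = ip u f\<close> it is the projection of \<open>f\<close> to the
  closure of \<open>V\<close>.\<close>

lemma subspace_riesz:
  fixes L :: "('a \<Rightarrow> complex) \<Rightarrow> complex"
  assumes VH: "V \<subseteq> H" and V0: "(\<lambda>_. 0) \<in> V"
    and Vadd: "\<And>u v. u \<in> V \<Longrightarrow> v \<in> V \<Longrightarrow> (\<lambda>x. u x + v x) \<in> V"
    and Vscale: "\<And>c u. u \<in> V \<Longrightarrow> (\<lambda>x. c * u x) \<in> V"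
    and Ladd: "\<And>u v. u \<in> V \<Longrightarrow> v \<in> V \<Longrightarrow> L (\<lambda>x. u x + v x) = L u + L v"
    and Lscale: "\<And>c u. u \<in> V \<Longrightarrow> L (\<lambda>x. c * u x) = c * L u"
    and Lbound: "\<And>u. u \<in> V \<Longrightarrow> cmod (L u) \<le> C * ip_norm ip u"
  shows "\<exists>v q. (\<forall>n :: nat. v n \<in> V) \<and> q \<in> H
    \<and> (\<lambda>n. ip_norm ip (\<lambda>x. v n x - q x)) \<longlonglongrightarrow> 0 \<and> (\<forall>u\<in>V. L u = ip u q)"
proof -
  define J where "J u = Re (ip u u) - 2 * Re (L u)" for u
  have J_lower: "- C\<^sup>2 \<le> J u" if "u \<in> V" for u
  proof -
    have u: "u \<in> H" using VH that by blast
    have "Re (L u) \<le> C * ip_norm ip u"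
      using Lbound[OF that] complex_Re_le_cmod[of "L u"] by linarith
    moreover have "0 \<le> (ip_norm ip u - C)\<^sup>2" by simp
    ultimately show ?thesis
      using ip_norm_square[OF u] by (simp add: J_def power2_diff mult.commute)
  qed
  define m where "m = Inf (J ` V)"
  have bdd: "bdd_below (J ` V)"
    using J_lower by (rule bdd_belowI2)
  have m_le: "m \<le> J u" if "u \<in> V" for u
    unfolding m_def using bdd that by (rule cINF_lower)
  have J_line: "J (\<lambda>x. u x + c * v x)
      = J u + (cmod c)\<^sup>2 * Re (ip v v) + 2 * Re (c * (ip v u - L v))"
    if uV: "u \<in> V" and vV: "v \<in> V" for u v c
  proof -
    have u: "u \<in> H" and v: "v \<in> H" using VH that by auto
    have cv: "(\<lambda>x. c * v x) \<in> H" using scale_mem v by blast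
    have "ip (\<lambda>x. u x + c * v x) (\<lambda>x. u x + c * v x)
      = ip u u + cnj c * ip u v + c * ip v u + c * cnj c * ip v v"
      by (simp add: ip_add_left[OF u cv add_mem[OF u cv]] ip_add_right[OF u cv] u cv
        ip_scale_left[OF v cv] ip_scale_left[OF v u] ip_scale_right[OF v u]
        ip_scale_right[OF v v] algebra_simps)
    moreover have "cnj c * ip u v = cnj (c * ip v u)"
      using ip_commute[OF v u] by simp
    ultimately have "Re (ip (\<lambda>x. u x + c * v x) (\<lambda>x. u x + c * v x))
      = Re (ip u u) + 2 * Re (c * ip v u) + (cmod c)\<^sup>2 * Re (ip v v)"
      by (simp add: complex_norm_square[symmetric])
    then show ?thesis
      using Ladd[OF uV Vscale[OF vV]] Lscale[OF vV] by (simp add: J_def algebra_simps)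
  qed
  have "\<exists>u\<in>V. J u < m + 1 / Suc n" for n
  proof -
    have "Inf (J ` V) < m + 1 / Suc n" by (simp add: m_def)
    then show ?thesis
      using cInf_less_iff[OF _ bdd] V0 by auto
  qed
  then have "\<forall>n. \<exists>u. u \<in> V \<and> J u < m + 1 / Suc n" by blast
  from choice[OF this] obtain v
    where vV: "\<And>n. v n \<in> V" and vJ: "\<And>n. J (v n) < m + 1 / Suc n"
    by blast
  have vH: "v n \<in> H" for n using vV VH by blast
  have gap: "(ip_norm ip (\<lambda>x. v i x - v j x))\<^sup>2 \<le> 2 * (1 / Suc i) + 2 * (1 / Suc j)" for i j
  proof -
    define d where "d = (\<lambda>x. v i x - v j x)"
    have dV: "d \<in> V"
      using Vadd[OF vV Vscale[OF vV, of "-1"], of i j] by (simp add: d_def)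
    \<comment> \<open>Parallelogram step: \<open>J (v i) + J (v j)\<close> minus twice the value of
      \<open>J\<close> at the midpoint equals \<open>Re (ip d d) / 2\<close>, and the midpoint value
      is at least \<open>m\<close>. Hence a minimising sequence is Cauchy.\<close>
    have half: "J (\<lambda>x. v j x + (1/2) * d x)
        = J (v j) + Re (ip d d) / 4 + Re (ip d (v j) - L d)"
      using J_line[OF vV dV, of j "1/2"] by (simp add: power2_eq_square)
    have "J (v i) = J (v j) + Re (ip d d) + 2 * Re (ip d (v j) - L d)"
      using J_line[OF vV dV, of j 1] by (simp add: d_def)
    moreover have "m \<le> J (\<lambda>x. v j x + (1/2) * d x)"
      using m_le Vadd vV Vscale dV by blast
    ultimately have "Re (ip d d) \<le> 2 * (J (v i) - m) + 2 * (J (v j) - m)"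
      using half by simp
    moreover have "(ip_norm ip d)\<^sup>2 = Re (ip d d)"
      using ip_norm_square dV VH by blast
    ultimately show ?thesis
      using vJ[of i] vJ[of j] unfolding d_def by argo
  qed
  have "\<exists>q\<in>H. (\<lambda>n. ip_norm ip (\<lambda>x. v n x - q x)) \<longlonglongrightarrow> 0"
  proof (rule complete)
    fix e :: real assume e: "0 < e"
    then obtain N where N: "1 / real (Suc N) < e\<^sup>2 / 4"
      using reals_Archimedean[of "e\<^sup>2 / 4"] by (auto simp: inverse_eq_divide)
    have "ip_norm ip (\<lambda>x. v i x - v j x) < e" if "i \<ge> N" "j \<ge> N" for i j
    proof -
      have "1 / real (Suc i) \<le> 1 / real (Suc N)" "1 / real (Suc j) \<le> 1 / real (Suc N)"
        using that by (simp_all add: frac_le)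
      then have "(ip_norm ip (\<lambda>x. v i x - v j x))\<^sup>2 < e\<^sup>2"
        using gap[of i j] N by linarith
      then show ?thesis
        using e by (intro power2_less_imp_less[of _ e]) auto
    qed
    then show "\<exists>N. \<forall>i\<ge>N. \<forall>j\<ge>N. ip_norm ip (\<lambda>x. v i x - v j x) < e" by blast
  qed (rule vH)
  then obtain q where q: "q \<in> H" and lim: "(\<lambda>n. ip_norm ip (\<lambda>x. v n x - q x)) \<longlonglongrightarrow> 0"
    by blast
  have Jlim: "(\<lambda>n. J (v n)) \<longlonglongrightarrow> m"
  proof (rule tendsto_sandwich[of "\<lambda>_. m" _ _ "\<lambda>n. m + 1 / Suc n"])
    show "(\<lambda>n. m + 1 / real (Suc n)) \<longlonglongrightarrow> m"
      using tendsto_add[OF tendsto_const LIMSEQ_inverse_real_of_nat, of m]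
      by (simp add: inverse_eq_divide)
  qed (use m_le vV vJ in \<open>auto intro!: always_eventually less_imp_le\<close>)
  have ip_lim: "(\<lambda>n. ip u (v n)) \<longlonglongrightarrow> ip u q" if u: "u \<in> H" for u
  proof -
    have "(\<lambda>n. ip u (v n) - ip u q) \<longlonglongrightarrow> 0"
    proof (rule Lim_null_comparison)
      show "(\<lambda>n. ip_norm ip u * ip_norm ip (\<lambda>x. v n x - q x)) \<longlonglongrightarrow> 0"
        using tendsto_mult_right_zero[OF lim] .
      show "\<forall>\<^sub>F n in sequentially.
          cmod (ip u (v n) - ip u q) \<le> ip_norm ip u * ip_norm ip (\<lambda>x. v n x - q x)"
        using Cauchy_Schwarz[OF u diff_mem[OF vH q]] ip_diff_right[OF vH q u]
        by (simp add: always_eventually)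
    qed
    then show ?thesis by (simp add: LIM_zero_iff)
  qed
  \<comment> \<open>The limit \<open>q\<close> may lie outside \<open>V\<close>, where nothing is
    assumed about \<open>L\<close>. The variational inequality at \<open>q\<close> is therefore
    obtained as the limit of the inequalities at the points \<open>v n\<close>.\<close>
  have pos: "0 \<le> (cmod c)\<^sup>2 * Re (ip u u) + 2 * Re (c * (ip u q - L u))" if "u \<in> V" for u c
  proof -
    have u: "u \<in> H" using that VH by blast
    have "(\<lambda>n. J (v n) + (cmod c)\<^sup>2 * Re (ip u u) + 2 * Re (c * (ip u (v n) - L u)))
       \<longlonglongrightarrow> m + (cmod c)\<^sup>2 * Re (ip u u) + 2 * Re (c * (ip u q - L u))"
      by (intro tendsto_intros Jlim ip_lim u)
    moreover have "m \<le> J (v n) + (cmod c)\<^sup>2 * Re (ip u u) + 2 * Re (c * (ip u (v n) - L u))" for n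
      using m_le[OF Vadd[OF vV Vscale[OF that]], of n c] J_line[OF vV that, of n c] by simp
    ultimately have "m \<le> m + (cmod c)\<^sup>2 * Re (ip u u) + 2 * Re (c * (ip u q - L u))"
      by (intro LIMSEQ_le_const) auto
    then show ?thesis by simp
  qed
  have rep: "L u = ip u q" if uV: "u \<in> V" for u
  proof -
    define D where "D = ip u q - L u"
    \<comment> \<open>The coefficient \<open>- cnj D / S\<close> nearly minimises the quadratic in
      \<open>pos\<close>. The added 1 keeps the denominator positive when \<open>u\<close> is zero
      and still leaves a negative value unless \<open>D\<close> vanishes.\<close>
    define S where "S = Re (ip u u) + 1"
    have S: "S \<ge> 1" using ip_nonneg uV VH by (auto simp: S_def)
    have "0 \<le> (cmod (- cnj D / S))\<^sup>2 * Re (ip u u) + 2 * Re (- cnj D / S * D)"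
      using pos[OF uV, of "- cnj D / S"] by (simp add: D_def)
    also have "Re (- cnj D / S * D) = - (cmod D)\<^sup>2 / S"
      by (simp add: cmod_power2 diff_divide_distrib add_divide_distrib flip: power2_eq_square)
    also have "cmod (- cnj D / S) = cmod D / S"
      using S by (simp add: norm_divide)
    also have "Re (ip u u) = S - 1"
      by (simp add: S_def)
    also have "(cmod D / S)\<^sup>2 * (S - 1) + 2 * (- (cmod D)\<^sup>2 / S)
        = - (cmod D)\<^sup>2 * (S + 1) / S\<^sup>2"
      using S by (simp add: field_simps power2_eq_square)
    finally have "(cmod D)\<^sup>2 * (S + 1) \<le> 0"
      using S by (simp add: divide_le_0_iff zero_le_divide_iff)
    then have "D = 0"
      using S by (simp add: mult_le_0_iff)
    then show ?thesis by (simp add: D_def)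
  qed
  show ?thesis using vV q lim rep by blast
qed

text \<open>The limit \<open>q\<close> supplied by \<open>subspace_riesz\<close> has the same inner
  products with \<open>V\<close> as \<open>f\<close>. Since \<open>V\<close> contains the kernel
  sections, \<open>f\<close> and \<open>q\<close> agree at every point, so \<open>f\<close> itself
  is a limit of elements of \<open>V\<close>.\<close>

lemma dense_subspace:
  assumes VH: "V \<subseteq> H" and V0: "(\<lambda>_. 0) \<in> V"
    and Vadd: "\<And>u v. u \<in> V \<Longrightarrow> v \<in> V \<Longrightarrow> (\<lambda>x. u x + v x) \<in> V"
    and Vscale: "\<And>c u. u \<in> V \<Longrightarrow> (\<lambda>x. c * u x) \<in> V"
    and Vkernel: "\<And>w. w \<in> X \<Longrightarrow> kernel_section X K w \<in> V"
    and f: "f \<in> H" and e: "0 < e"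
  obtains p where "p \<in> V" "ip_norm ip (\<lambda>x. f x - p x) < e"
proof -
  have "\<exists>v q. (\<forall>n :: nat. v n \<in> V) \<and> q \<in> H
    \<and> (\<lambda>n. ip_norm ip (\<lambda>x. v n x - q x)) \<longlonglongrightarrow> 0 \<and> (\<forall>u\<in>V. ip u f = ip u q)"
  proof (rule subspace_riesz[OF VH V0 Vadd Vscale])
    show "ip (\<lambda>x. u x + v x) f = ip u f + ip v f" if "u \<in> V" "v \<in> V" for u v
      using ip_add_left[of u v f] that VH f by auto
    show "ip (\<lambda>x. c * u x) f = c * ip u f" if "u \<in> V" for c u
      using ip_scale_left[of u f c] that VH f by auto
    show "cmod (ip u f) \<le> ip_norm ip f * ip_norm ip u" if "u \<in> V" for u
      using Cauchy_Schwarz[of u f] that VH f by (auto simp: mult.commute)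
  qed
  then obtain v q where vV: "\<And>n. v n \<in> V" and q: "q \<in> H"
    and lim: "(\<lambda>n. ip_norm ip (\<lambda>x. v n x - q x)) \<longlonglongrightarrow> 0"
    and rep: "\<And>u. u \<in> V \<Longrightarrow> ip u f = ip u q"
    by blast
  have "f x = q x" for x
  proof (cases "x \<in> X")
    case True
    then show ?thesis
      using rep[OF Vkernel[OF True]] reproducing[OF f True] reproducing[OF q True]
        ip_commute[OF kernel_mem[OF True] f] ip_commute[OF kernel_mem[OF True] q] by simp
  next
    case False
    then show ?thesis using zero_outside f q by metis
  qed
  then have fq: "f = q" by blast
  have "\<forall>\<^sub>F n in sequentially. ip_norm ip (\<lambda>x. v n x - q x) < e"
    using order_tendstoD(2)[OF lim e] .
  then obtain n where n: "ip_norm ip (\<lambda>x. v n x - q x) < e"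
    by (auto simp: eventually_sequentially)
  then show thesis
    using that[OF vV[of n]] ip_norm_minus_commute[of "v n" q] vV[of n] VH q fq by auto
qed

lemma riesz:
  fixes L :: "('a \<Rightarrow> complex) \<Rightarrow> complex"
  assumes "\<And>u v. u \<in> H \<Longrightarrow> v \<in> H \<Longrightarrow> L (\<lambda>x. u x + v x) = L u + L v"
    and "\<And>c u. u \<in> H \<Longrightarrow> L (\<lambda>x. c * u x) = c * L u"
    and "\<And>u. u \<in> H \<Longrightarrow> cmod (L u) \<le> C * ip_norm ip u"
  obtains k where "k \<in> H" "\<And>u. u \<in> H \<Longrightarrow> L u = ip u k"
  using subspace_riesz[OF order_refl zero_mem add_mem scale_mem assms] that by blast

section \<open>Pointwise estimates from the reproducing property\<close>

lemma kernel_commute: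
  assumes "z \<in> X" "w \<in> X"
  shows "K w z = cnj (K z w)"
  using reproducing[OF kernel_mem[OF assms(2)] assms(1)]
    reproducing[OF kernel_mem[OF assms(1)] assms(2)]
    ip_commute[OF kernel_mem[OF assms(2)] kernel_mem[OF assms(1)]] assms
  by (simp add: kernel_section_def)

lemma evaluation_bound:
  assumes "f \<in> H" "w \<in> X"
  shows "cmod (f w) \<le> ip_norm ip f * sqrt (Re (K w w))"
  using Cauchy_Schwarz[OF assms(1) kernel_mem[OF assms(2)]] reproducing[OF assms]
    reproducing[OF kernel_mem[OF assms(2)] assms(2)] assms(2)
  by (simp add: ip_norm_def kernel_section_def)

text \<open>The radicand is the squared norm of the difference of the kernel sections at
  \<open>z\<close> and \<open>w\<close>. In this way continuity of the kernel passes to every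
  element of \<open>H\<close>.\<close>

lemma evaluation_diff_bound:
  assumes f: "f \<in> H" and z: "z \<in> X" and w: "w \<in> X"
  shows "cmod (f z - f w) \<le> ip_norm ip f * sqrt (Re (K z z - K z w - K w z + K w w))"
proof -
  let ?k = "kernel_section X K"
  have kz: "?k z \<in> H" and kw: "?k w \<in> H"
    using kernel_mem z w by auto
  have "ip (\<lambda>x. ?k z x - ?k w x) (\<lambda>x. ?k z x - ?k w x) = ?k z z - ?k z w - (?k w z - ?k w w)"
    using reproducing[OF kz z] reproducing[OF kz w] reproducing[OF kw z] reproducing[OF kw w]
    by (simp add: ip_diff_left[OF kz kw diff_mem[OF kz kw]] ip_diff_right[OF kz kw] kz kw)
  also have "\<dots> = K z z - K w z - (K z w - K w w)"
    using z w by (simp add: kernel_section_def)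
  finally have "ip (\<lambda>x. ?k z x - ?k w x) (\<lambda>x. ?k z x - ?k w x) = K z z - K w z - (K z w - K w w)" .
  moreover have "f z - f w = ip f (\<lambda>x. ?k z x - ?k w x)"
    using reproducing[OF f] z w ip_diff_right[OF kz kw f] by simp
  ultimately show ?thesis
    using Cauchy_Schwarz[OF f diff_mem[OF kz kw]]
    by (simp only: ip_norm_def) (simp add: algebra_simps)
qed

end

section \<open>The kernel of a unitarily invariant space\<close>

lemma norm_hinner_le: "cmod (hinner z w) \<le> norm z * norm w"
proof -
  have "cmod (hinner z w) \<le> (\<Sum>i\<in>UNIV. \<bar>norm (z $ i)\<bar> * \<bar>norm (w $ i)\<bar>)"
    unfolding hinner_def by (rule order_trans[OF norm_sum]) (simp add: norm_mult)
  also have "\<dots> \<le> norm z * norm w"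
    unfolding norm_vec_def by (rule L2_set_mult_ineq)
  finally show ?thesis .
qed

lemma continuous_on_hinner [continuous_intros]:
  assumes "continuous_on S f" "continuous_on S g"
  shows "continuous_on S (\<lambda>x. hinner (f x) (g x))"
  unfolding hinner_def using assms by (intro continuous_intros) auto

lemma continuous_on_powser_ball:
  fixes c :: "nat \<Rightarrow> complex"
  assumes "\<And>y :: real. 0 < y \<Longrightarrow> y < 1 \<Longrightarrow> summable (\<lambda>n. c n * of_real y ^ n)"
  shows "continuous_on (ball 0 1) (\<lambda>x. \<Sum>n. c n * x ^ n)"
proof (intro continuous_at_imp_continuous_on ballI)
  fix x :: complex assume "x \<in> ball 0 1"
  then obtain y where y: "norm x < y" "y < 1"
    using dense[of "norm x" 1] by auto
  then have "0 < y" using norm_ge_zero[of x] by linarith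
  then show "isCont (\<lambda>x. \<Sum>n. c n * x ^ n) x"
    using assms[of y] y by (intro isCont_powser[of c "of_real y"]) auto
qed

context unitarily_invariant_space
begin

lemma kernel_continuous_form:
  obtains A B :: "complex \<Rightarrow> complex"
  where "continuous_on (ball 0 1) A" "continuous_on (ball 0 1) B" "A 0 + B 0 = 1"
    "\<And>z w. z \<in> ball 0 1 \<Longrightarrow> w \<in> ball 0 1 \<Longrightarrow> K z w = A (hinner z w) + B (cnj (hinner z w))"
proof -
  obtain a :: "int \<Rightarrow> real" where a0: "a 0 = 1"
    and form: "\<forall>z\<in>ball 0 1. \<forall>w\<in>ball 0 1.
          summable (\<lambda>n. complex_of_real (a (int n)) * hinner z w ^ n) \<and>
          summable (\<lambda>n. complex_of_real (a (- int (Suc n))) * cnj (hinner z w) ^ Suc n) \<and>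
          K z w = (\<Sum>n. complex_of_real (a (int n)) * hinner z w ^ n)
                + (\<Sum>n. complex_of_real (a (- int (Suc n))) * cnj (hinner z w) ^ Suc n)"
    using kernel_form by - (elim exE conjE, rule that, assumption+)
  note sA = form[rule_format, THEN conjunct1]
    and sB = form[rule_format, THEN conjunct2, THEN conjunct1]
    and K = form[rule_format, THEN conjunct2, THEN conjunct2]
  define A where "A x = (\<Sum>n. complex_of_real (a (int n)) * x ^ n)" for x
  define B0 where "B0 x = (\<Sum>n. complex_of_real (a (- int (Suc n))) * x ^ n)" for x
  \<comment> \<open>The diagonal values \<open>hinner z z\<close> cover the interval (0, 1), so
    convergence of the kernel series on the ball yields convergence of both power series at positive
    reals.\<close>
  have point: "\<exists>z\<in>ball 0 1 :: (complex ^ 'd) set. hinner z z = of_real y"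
    if "0 < y" "y < 1" for y :: real
  proof
    define k :: 'd where "k = undefined"
    define z :: "complex ^ 'd" where "z = axis k (of_real (sqrt y))"
    show "hinner z z = of_real y"
      using that by (simp add: hinner_def z_def axis_def if_distrib[of "\<lambda>x. x * _"] if_distrib[of cnj]
          flip: of_real_mult cong: if_cong)
    have "norm z = sqrt y"
      using that by (simp add: norm_vec_def L2_set_def z_def axis_def if_distrib[of norm]
          if_distrib[of "\<lambda>x. x\<^sup>2"] cong: if_cong)
    then show "z \<in> ball 0 1" using that by simp
  qed
  have contA: "continuous_on (ball 0 1) A"
    unfolding A_def
  proof (rule continuous_on_powser_ball)
    fix y :: real assume y: "0 < y" "y < 1"
    then show "summable (\<lambda>n. complex_of_real (a (int n)) * of_real y ^ n)"
      using point[OF y] sA by metis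
  qed
  have contB0: "continuous_on (ball 0 1) B0"
    unfolding B0_def
  proof (rule continuous_on_powser_ball)
    fix y :: real assume y: "0 < y" "y < 1"
    obtain z :: "complex ^ 'd" where z: "z \<in> ball 0 1" "hinner z z = of_real y"
      using point[OF y] by blast
    have "summable (\<lambda>n. of_real y * (complex_of_real (a (- int (Suc n))) * of_real y ^ n))"
      using sB[OF z(1) z(1)] z(2) by (simp add: mult_ac)
    then show "summable (\<lambda>n. complex_of_real (a (- int (Suc n))) * of_real y ^ n)"
      by (rule summable_mult_D) (use y in simp)
  qed
  \<comment> \<open>The series of negative indices starts with exponent 1, so one factor
    \<open>x\<close> is split off to reach the power series \<open>B0\<close>. At
    \<open>x = 0\<close> summability cannot be divided by \<open>x\<close>, but both sides
    vanish.\<close>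
  have B: "(\<Sum>n. complex_of_real (a (- int (Suc n))) * x ^ Suc n) = x * B0 x"
    if "norm x < 1" "summable (\<lambda>n. complex_of_real (a (- int (Suc n))) * x ^ Suc n)" for x
  proof (cases "x = 0")
    case False
    have "summable (\<lambda>n. x * (complex_of_real (a (- int (Suc n))) * x ^ n))"
      using that(2) by (simp add: mult_ac)
    then have "summable (\<lambda>n. complex_of_real (a (- int (Suc n))) * x ^ n)"
      using False by (simp add: summable_mult_D)
    from suminf_mult[OF this, of x] show ?thesis
      by (simp add: B0_def mult_ac)
  qed simp
  show thesis
  proof (rule that[of A "\<lambda>x. x * B0 x"])
    show "A 0 + 0 * B0 0 = 1"
      by (simp add: A_def a0)
    show "continuous_on (ball 0 1) (\<lambda>x. x * B0 x)"
      by (intro continuous_intros contB0)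
    fix z w :: "complex ^ 'd" assume zw: "z \<in> ball 0 1" "w \<in> ball 0 1"
    have "norm z * norm w < 1"
      using zw mult_strict_mono'[of "norm z" 1 "norm w" 1] by simp
    then have "norm (cnj (hinner z w)) < 1"
      using norm_hinner_le[of z w] by simp
    from B[OF this sB[OF zw]] show "K z w = A (hinner z w) + cnj (hinner z w) * B0 (cnj (hinner z w))"
      using K[OF zw] by (simp add: A_def)
  qed (rule contA)
qed

lemma kernel_zero: "z \<in> ball 0 1 \<Longrightarrow> K z 0 = 1"
  by (rule kernel_continuous_form) (simp add: hinner_def)

text \<open>Scaling both arguments keeps \<open>hinner\<close> within modulus r^2 < 1, away from the
  unit circle where the series may diverge.\<close>

lemma continuous_on_kernel_scaled:
  assumes r: "0 \<le> r" "r < 1"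
  shows "continuous_on (sphere 0 1 \<times> sphere 0 1) (\<lambda>(z, w). K (r *\<^sub>R z) (r *\<^sub>R w))"
proof -
  obtain A B :: "complex \<Rightarrow> complex" where AB: "continuous_on (ball 0 1) A" "continuous_on (ball 0 1) B"
    and K: "\<And>z w. z \<in> ball 0 1 \<Longrightarrow> w \<in> ball 0 1 \<Longrightarrow> K z w = A (hinner z w) + B (cnj (hinner z w))"
    using kernel_continuous_form by metis
  let ?S = "sphere 0 1 :: (complex ^ 'd) set"
  let ?h = "\<lambda>p. hinner (r *\<^sub>R fst p) (r *\<^sub>R snd p)"
  have h: "cmod (?h p) < 1" if "p \<in> ?S \<times> ?S" for p
  proof -
    have "cmod (?h p) \<le> r * r"
      using norm_hinner_le[of "r *\<^sub>R fst p" "r *\<^sub>R snd p"] that r by (auto simp: mem_Times_iff)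
    also have "\<dots> < 1" using r mult_strict_mono'[of r 1 r 1] by simp
    finally show ?thesis .
  qed
  have "continuous_on (?S \<times> ?S) (\<lambda>p. A (?h p) + B (cnj (?h p)))"
    using h by (intro continuous_intros continuous_on_compose2[OF AB(1)]
        continuous_on_compose2[OF AB(2)]) auto
  then show ?thesis
    by (rule continuous_on_eq) (use r in \<open>auto simp: K\<close>)
qed

text \<open>For fixed \<open>w\<close> in the open ball, \<open>hinner z w\<close> has modulus at
  most \<open>norm w < 1\<close> even when \<open>z\<close> reaches the sphere. The section thus
  extends continuously to the compact closed ball.\<close>

lemma uniformly_continuous_kernel_section:
  assumes w: "w \<in> ball 0 1"
  shows "uniformly_continuous_on (ball 0 1) (kernel_section (ball 0 1) K w)"
proof -
  obtain A B :: "complex \<Rightarrow> complex" where AB: "continuous_on (ball 0 1) A" "continuous_on (ball 0 1) B"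
    and K: "\<And>z w. z \<in> ball 0 1 \<Longrightarrow> w \<in> ball 0 1 \<Longrightarrow> K z w = A (hinner z w) + B (cnj (hinner z w))"
    using kernel_continuous_form by metis
  have h: "cmod (hinner z w) < 1" if "z \<in> cball 0 1" for z
  proof -
    have "cmod (hinner z w) \<le> norm z * norm w" by (rule norm_hinner_le)
    also have "\<dots> \<le> 1 * norm w" using that by (intro mult_right_mono) auto
    finally show ?thesis using w by simp
  qed
  have "continuous_on (cball 0 1) (\<lambda>z. A (hinner z w) + B (cnj (hinner z w)))"
    using h by (intro continuous_intros continuous_on_compose2[OF AB(1)]
        continuous_on_compose2[OF AB(2)]) auto
  then have unif: "uniformly_continuous_on (cball 0 1) (\<lambda>z. A (hinner z w) + B (cnj (hinner z w)))"
    by (rule compact_uniformly_continuous) simp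
  have eq: "kernel_section (ball 0 1) K w z = A (hinner z w) + B (cnj (hinner z w))"
    if "z \<in> ball 0 1" for z
    using K[OF that w] that by (simp add: kernel_section_def)
  show ?thesis
    unfolding uniformly_continuous_on_def
  proof (intro allI impI)
    fix e :: real assume "0 < e"
    then obtain d where d: "0 < d" and *: "\<And>x y. x \<in> cball 0 1 \<Longrightarrow> y \<in> cball 0 1 \<Longrightarrow> dist y x < d \<Longrightarrow>
        dist (A (hinner y w) + B (cnj (hinner y w))) (A (hinner x w) + B (cnj (hinner x w))) < e"
      by (rule uniformly_continuous_onE[OF unif]) (rule that)
    show "\<exists>d>0. \<forall>x\<in>ball 0 1. \<forall>y\<in>ball 0 1. dist y x < d \<longrightarrow>
        dist (kernel_section (ball 0 1) K w y) (kernel_section (ball 0 1) K w x) < e"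
      using d * by (intro exI[of _ d] conjI ballI impI) (simp_all add: eq)
  qed
qed

lemma dense_uniformly_continuous:
  assumes "f \<in> H" "0 < e"
  obtains p where "p \<in> H" "uniformly_continuous_on (ball 0 1) p" "ip_norm ip (\<lambda>x. f x - p x) < e"
proof -
  let ?V = "{p \<in> H. uniformly_continuous_on (ball 0 1) p}"
  have "\<exists>p\<in>?V. ip_norm ip (\<lambda>x. f x - p x) < e"
  proof (rule dense_subspace[of ?V f e])
    show "(\<lambda>x. c * u x) \<in> ?V" if "u \<in> ?V" for c u
      using that scale_mem[of u c]
        bounded_linear.uniformly_continuous_on[OF bounded_linear_mult_right, of "ball 0 1" u c] by auto
  qed (use assms zero_mem add_mem kernel_mem uniformly_continuous_kernel_section in
      \<open>auto intro: uniformly_continuous_on_add uniformly_continuous_on_const\<close>)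
  then show thesis using that by blast
qed

lemma kernel_scaled_bounded:
  assumes r: "0 \<le> r" "r < 1"
  obtains C where "0 \<le> C" "\<And>z w. z \<in> sphere 0 1 \<Longrightarrow> w \<in> sphere 0 1 \<Longrightarrow> cmod (K (r *\<^sub>R z) (r *\<^sub>R w)) \<le> C"
proof -
  have "bounded ((\<lambda>(z, w). K (r *\<^sub>R z) (r *\<^sub>R w)) ` (sphere 0 1 \<times> sphere 0 1))"
    by (intro compact_imp_bounded compact_continuous_image continuous_on_kernel_scaled r compact_Times) auto
  then obtain C where "\<And>z w. z \<in> sphere 0 1 \<Longrightarrow> w \<in> sphere 0 1 \<Longrightarrow> cmod (K (r *\<^sub>R z) (r *\<^sub>R w)) \<le> C"
    unfolding bounded_iff by fast
  then show thesis using that[of "max C 0"] by (auto simp: le_max_iff_disj)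
qed

text \<open>Elements of \<open>H\<close> come without a series expansion;
  \<open>evaluation_diff_bound\<close> gives continuity, since its radicand is continuous in the
  moving point and vanishes when both points coincide.\<close>

lemma continuous_on_scaled:
  assumes f: "f \<in> H" and r: "0 \<le> r" "r < 1"
  shows "continuous_on (sphere 0 1) (\<lambda>\<zeta>. f (r *\<^sub>R \<zeta>))"
  unfolding continuous_on_def
proof
  fix z :: "complex ^ 'd" assume z: "z \<in> sphere 0 1"
  let ?S = "sphere 0 1 :: (complex ^ 'd) set"
  let ?K = "\<lambda>z w. K (r *\<^sub>R z) (r *\<^sub>R w)"
  have K: "continuous_on ?S (\<lambda>w. ?K (a w) (b w))"
    if "continuous_on ?S a" "continuous_on ?S b" "a ` ?S \<subseteq> ?S" "b ` ?S \<subseteq> ?S" for a b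
    using continuous_on_compose2[OF continuous_on_kernel_scaled[OF r], of ?S "\<lambda>w. (a w, b w)"] that
    by (auto intro: continuous_on_Pair)
  have "continuous_on ?S (\<lambda>w. ip_norm ip f * sqrt (Re (?K w w - ?K w z - ?K z w + ?K z z)))"
    using z by (intro continuous_intros K) auto
  then have "((\<lambda>w. ip_norm ip f * sqrt (Re (?K w w - ?K w z - ?K z w + ?K z z)))
      \<longlongrightarrow> ip_norm ip f * sqrt (Re (?K z z - ?K z z - ?K z z + ?K z z))) (at z within ?S)"
    using z unfolding continuous_on_def by blast
  then have lim: "((\<lambda>w. ip_norm ip f * sqrt (Re (?K w w - ?K w z - ?K z w + ?K z z)))
      \<longlongrightarrow> 0) (at z within ?S)"
    by simp
  have "((\<lambda>w. f (r *\<^sub>R w) - f (r *\<^sub>R z)) \<longlongrightarrow> 0) (at z within ?S)"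
  proof (rule Lim_null_comparison[OF _ lim])
    show "\<forall>\<^sub>F w in at z within ?S. norm (f (r *\<^sub>R w) - f (r *\<^sub>R z))
        \<le> ip_norm ip f * sqrt (Re (?K w w - ?K w z - ?K z w + ?K z z))"
      unfolding eventually_at_filter
      using z r by (intro always_eventually allI impI evaluation_diff_bound f) auto
  qed
  then show "((\<lambda>w. f (r *\<^sub>R w)) \<longlongrightarrow> f (r *\<^sub>R z)) (at z within ?S)"
    by (simp add: LIM_zero_iff)
qed

end

section \<open>Potentials and energy\<close>

lemma space_sphere_borel [simp]: "space sphere_borel = sphere 0 1"
  by (simp add: sphere_borel_def space_restrict_space)

lemma borel_measurable_sphere:
  "continuous_on (sphere 0 1) f \<Longrightarrow> f \<in> borel_measurable sphere_borel"
  unfolding sphere_borel_def by (rule borel_measurable_continuous_on_restrict)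

lemma sets_sphere_borel_closed: "closed F \<Longrightarrow> F \<subseteq> sphere 0 1 \<Longrightarrow> F \<in> sets sphere_borel"
  by (simp add: sphere_borel_def sets_restrict_space_iff borel_closed)

lemma sets_sphere_borel_openin:
  assumes "openin (top_of_set (sphere 0 1)) G"
  shows "G \<in> sets sphere_borel"
proof -
  obtain T where "open T" "G = sphere 0 1 \<inter> T"
    using assms by (auto simp: openin_open)
  then show ?thesis
    by (auto simp: sphere_borel_def sets_restrict_space)
qed

context unitarily_invariant_space
begin

lemma continuous_on_kernel_slice:
  assumes "0 \<le> r" "r < 1" "z \<in> sphere 0 1"
  shows "continuous_on (sphere 0 1) (\<lambda>w. K (r *\<^sub>R z) (r *\<^sub>R w))"
proof -
  have "continuous_on (sphere 0 1) (\<lambda>w. (z, w))"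
    by (intro continuous_intros)
  moreover have "(\<lambda>w. (z, w)) ` sphere 0 1 \<subseteq> sphere 0 1 \<times> sphere 0 1"
    using assms(3) by auto
  ultimately show ?thesis
    using continuous_on_compose2[OF continuous_on_kernel_scaled[OF assms(1,2)]] by fastforce
qed

text \<open>For fixed r < 1 the kernel is bounded on the sphere of radius r, so integrating the
  dilate against h \<mu> is a bounded functional on \<open>H\<close>. Its Riesz representer
  \<open>k\<close> is the potential of h \<mu>.\<close>

lemma potential:
  assumes \<mu>: "finite_measure \<mu>" "sets \<mu> = sets sphere_borel" and r: "0 \<le> r" "r < 1"
    and h: "h \<in> borel_measurable \<mu>" "\<And>x. \<bar>h x\<bar> \<le> (1 :: real)"
  obtains k where "k \<in> H" "\<And>f. f \<in> H \<Longrightarrow> ip f k = (\<integral>\<zeta>. f (r *\<^sub>R \<zeta>) * h \<zeta> \<partial>\<mu>)"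
    "\<And>z. z \<in> sphere 0 1 \<Longrightarrow> k (r *\<^sub>R z) = (\<integral>w. K (r *\<^sub>R z) (r *\<^sub>R w) * h w \<partial>\<mu>)"
proof -
  interpret finite_measure \<mu> by fact
  have space: "space \<mu> = sphere 0 1"
    using sets_eq_imp_space_eq[OF \<mu>(2)] by simp
  have meas: "(\<lambda>\<zeta>. f (r *\<^sub>R \<zeta>)) \<in> borel_measurable \<mu>" if "f \<in> H" for f
    using borel_measurable_sphere[OF continuous_on_scaled[OF that r]] \<mu>(2)
    by (simp cong: measurable_cong_sets)
  obtain C where C: "0 \<le> C"
    "\<And>z w. z \<in> sphere 0 1 \<Longrightarrow> w \<in> sphere 0 1 \<Longrightarrow> cmod (K (r *\<^sub>R z) (r *\<^sub>R w)) \<le> C"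
    by (rule kernel_scaled_bounded[OF r]) (rule that)
  have bound: "cmod (f (r *\<^sub>R \<zeta>) * h \<zeta>) \<le> sqrt C * ip_norm ip f"
    if f: "f \<in> H" and \<zeta>: "\<zeta> \<in> sphere 0 1" for f \<zeta>
  proof -
    have "cmod (f (r *\<^sub>R \<zeta>) * h \<zeta>) \<le> cmod (f (r *\<^sub>R \<zeta>)) * 1"
      unfolding norm_mult using h(2)[of \<zeta>] by (intro mult_left_mono) auto
    also have "\<dots> \<le> ip_norm ip f * sqrt (Re (K (r *\<^sub>R \<zeta>) (r *\<^sub>R \<zeta>)))"
      using evaluation_bound[OF f, of "r *\<^sub>R \<zeta>"] r \<zeta> by simp
    also have "\<dots> \<le> ip_norm ip f * sqrt C"
      using C(2)[OF \<zeta> \<zeta>] complex_Re_le_cmod[of "K (r *\<^sub>R \<zeta>) (r *\<^sub>R \<zeta>)"]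
      by (intro mult_left_mono ip_norm_nonneg f) auto
    finally show ?thesis by (simp add: mult.commute)
  qed
  have int: "integrable \<mu> (\<lambda>\<zeta>. f (r *\<^sub>R \<zeta>) * h \<zeta>)" if f: "f \<in> H" for f
    using bound[OF f] meas[OF f] h(1) space
    by (intro integrable_const_bound[of _ "sqrt C * ip_norm ip f"]) auto
  obtain k where k: "k \<in> H" "\<And>f. f \<in> H \<Longrightarrow> (\<integral>\<zeta>. f (r *\<^sub>R \<zeta>) * h \<zeta> \<partial>\<mu>) = ip f k"
  proof (rule riesz)
    show "cmod (\<integral>\<zeta>. f (r *\<^sub>R \<zeta>) * h \<zeta> \<partial>\<mu>) \<le> (sqrt C * measure \<mu> (space \<mu>)) * ip_norm ip f"
      if f: "f \<in> H" for f
    proof -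
      have "cmod (\<integral>\<zeta>. f (r *\<^sub>R \<zeta>) * h \<zeta> \<partial>\<mu>) \<le> (\<integral>\<zeta>. sqrt C * ip_norm ip f \<partial>\<mu>)"
        using int[OF f] bound[OF f] space by (intro Bochner_Integration.integral_norm_bound_integral) auto
      then show ?thesis by (simp add: mult_ac)
    qed
  qed (use int in \<open>simp_all add: distrib_right mult.assoc\<close>)
  have point: "k (r *\<^sub>R z) = (\<integral>w. K (r *\<^sub>R z) (r *\<^sub>R w) * h w \<partial>\<mu>)" if z: "z \<in> sphere 0 1" for z
  proof -
    have rz: "r *\<^sub>R z \<in> ball 0 1" using z r by simp
    let ?s = "kernel_section (ball 0 1) K (r *\<^sub>R z)"
    \<comment> \<open>The representer sits in the conjugate-linear slot, so its value is the
      conjugate of the functional at a kernel section. As \<open>h\<close> is real, conjugation only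
      swaps the arguments of \<open>K\<close>.\<close>
    have "k (r *\<^sub>R z) = cnj (ip ?s k)"
      using reproducing[OF k(1) rz] ip_commute[OF k(1) kernel_mem[OF rz]] by simp
    also have "\<dots> = cnj (\<integral>w. ?s (r *\<^sub>R w) * h w \<partial>\<mu>)"
      using k(2)[OF kernel_mem[OF rz]] by simp
    also have "\<dots> = (\<integral>w. cnj (?s (r *\<^sub>R w) * h w) \<partial>\<mu>)"
      by (rule Bochner_Integration.integral_cnj[symmetric])
    also have "\<dots> = (\<integral>w. K (r *\<^sub>R z) (r *\<^sub>R w) * h w \<partial>\<mu>)"
      using r z kernel_commute[OF rz]
      by (intro Bochner_Integration.integral_cong) (auto simp: space kernel_section_def)
    finally show ?thesis .
  qed
  show thesis
    by (rule that[OF k(1) k(2)[symmetric] point])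
qed

end

section \<open>Energy estimates for kernels with non-negative real part\<close>

locale nonneg_kernel_space = unitarily_invariant_space H ip K
  for H :: "(complex ^ 'd \<Rightarrow> complex) set"
    and ip :: "(complex ^ 'd \<Rightarrow> complex) \<Rightarrow> (complex ^ 'd \<Rightarrow> complex) \<Rightarrow> complex"
    and K :: "complex ^ 'd \<Rightarrow> complex ^ 'd \<Rightarrow> complex" +
  assumes Re_kernel_nonneg: "z \<in> ball 0 1 \<Longrightarrow> w \<in> ball 0 1 \<Longrightarrow> 0 \<le> Re (K z w)"
begin

definition radial_energy :: "real \<Rightarrow> (complex ^ 'd) measure \<Rightarrow> real" where
  "radial_energy r \<mu> = Re (\<integral>z. (\<integral>w. K (r *\<^sub>R z) (r *\<^sub>R w) \<partial>\<mu>) \<partial>\<mu>)"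

text \<open>The squared norm of \<open>k\<close> is the double integral of K against the weights
  h(z) h(w). Since Re K is non-negative and the weights are at most 1 in modulus, removing them can
  only increase its real part, whatever their signs.\<close>

lemma weighted_potential:
  assumes \<mu>: "finite_measure \<mu>" "sets \<mu> = sets sphere_borel" and r: "0 \<le> r" "r < 1"
    and h: "h \<in> borel_measurable \<mu>" "\<And>x. \<bar>h x\<bar> \<le> (1 :: real)"
  obtains k where "k \<in> H" "\<And>f. f \<in> H \<Longrightarrow> ip f k = (\<integral>\<zeta>. f (r *\<^sub>R \<zeta>) * h \<zeta> \<partial>\<mu>)"
    "\<And>z. z \<in> sphere 0 1 \<Longrightarrow> k (r *\<^sub>R z) = (\<integral>w. K (r *\<^sub>R z) (r *\<^sub>R w) * h w \<partial>\<mu>)"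
    "Re (ip k k) \<le> radial_energy r \<mu>"
proof -
  interpret finite_measure \<mu> by fact
  have space: "space \<mu> = sphere 0 1"
    using sets_eq_imp_space_eq[OF \<mu>(2)] by simp
  have meas: "f \<in> borel_measurable \<mu>" if "continuous_on (sphere 0 1) f" for f :: "_ \<Rightarrow> complex"
    using borel_measurable_sphere[OF that] \<mu>(2) by (simp cong: measurable_cong_sets)
  have int: "integrable \<mu> (\<lambda>x. f x * g x)"
    if f: "continuous_on (sphere 0 1) f" and g: "g \<in> borel_measurable \<mu>" "\<And>x. \<bar>g x\<bar> \<le> (1 :: real)"
    for f :: "_ \<Rightarrow> complex" and g
  proof -
    have "bounded (f ` sphere 0 1)"
      by (intro compact_imp_bounded compact_continuous_image f) simp
    then obtain C where C: "\<And>x. x \<in> sphere 0 1 \<Longrightarrow> cmod (f x) \<le> C"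
      unfolding bounded_iff by fast
    have "cmod (f x * g x) \<le> C" if "x \<in> sphere 0 1" for x
      using mult_mono[OF C[OF that] g(2)[of x]] norm_ge_zero[of "f x"] C[OF that]
      by (simp add: norm_mult)
    then show ?thesis
      using meas[OF f] g(1) space by (intro integrable_const_bound[of _ C]) auto
  qed
  note Kcont = continuous_on_kernel_slice[OF r]
  obtain k where k: "k \<in> H" "\<And>f. f \<in> H \<Longrightarrow> ip f k = (\<integral>\<zeta>. f (r *\<^sub>R \<zeta>) * h \<zeta> \<partial>\<mu>)"
    "\<And>z. z \<in> sphere 0 1 \<Longrightarrow> k (r *\<^sub>R z) = (\<integral>w. K (r *\<^sub>R z) (r *\<^sub>R w) * h w \<partial>\<mu>)"
    by (rule potential[OF \<mu> r h]) (rule that)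
  \<comment> \<open>The potential of \<mu> itself. The weights are removed one variable at a time:
    first \<open>Re k\<close> is dominated by \<open>Re j\<close> on the sphere of radius r, then
    the outer integral is estimated.\<close>
  obtain j where j: "j \<in> H"
    "\<And>z. z \<in> sphere 0 1 \<Longrightarrow> j (r *\<^sub>R z) = (\<integral>w. K (r *\<^sub>R z) (r *\<^sub>R w) * of_real 1 \<partial>\<mu>)"
    by (rule potential[OF \<mu> r, of "\<lambda>_. 1"]) (simp_all add: that)
  have Re_mult: "Re (\<integral>w. f w * g w \<partial>\<mu>) = (\<integral>w. Re (f w) * g w \<partial>\<mu>)"
    if "integrable \<mu> (\<lambda>w. f w * complex_of_real (g w))" for f g
    using that by (subst integral_Re[symmetric]) simp_all
  have le: "\<bar>Re (k (r *\<^sub>R z))\<bar> \<le> Re (j (r *\<^sub>R z))" if z: "z \<in> sphere 0 1" for z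
  proof -
    note ih = int[OF Kcont[OF z] h] and i1 = int[OF Kcont[OF z], of "\<lambda>_. 1"]
    have "\<bar>Re (k (r *\<^sub>R z))\<bar> = \<bar>\<integral>w. Re (K (r *\<^sub>R z) (r *\<^sub>R w)) * h w \<partial>\<mu>\<bar>"
      using k(3)[OF z] Re_mult[OF ih] by simp
    also have "\<dots> \<le> (\<integral>w. Re (K (r *\<^sub>R z) (r *\<^sub>R w)) * 1 \<partial>\<mu>)"
    proof (rule integral_abs_bound_integral)
      show "integrable \<mu> (\<lambda>w. Re (K (r *\<^sub>R z) (r *\<^sub>R w)) * h w)"
        using integrable_Re[OF ih] by simp
      show "integrable \<mu> (\<lambda>w. Re (K (r *\<^sub>R z) (r *\<^sub>R w)) * 1)"
        using integrable_Re[OF i1] by simp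
      fix w assume "w \<in> space \<mu>"
      then have "0 \<le> Re (K (r *\<^sub>R z) (r *\<^sub>R w))"
        using z r space by (intro Re_kernel_nonneg) auto
      then show "\<bar>Re (K (r *\<^sub>R z) (r *\<^sub>R w)) * h w\<bar> \<le> Re (K (r *\<^sub>R z) (r *\<^sub>R w)) * 1"
        unfolding abs_mult using h(2)[of w] by (intro mult_mono) auto
    qed
    also have "\<dots> = Re (j (r *\<^sub>R z))"
      using j(2)[OF z] Re_mult[OF i1] by simp
    finally show ?thesis .
  qed
  have ik: "integrable \<mu> (\<lambda>z. k (r *\<^sub>R z) * h z)"
    by (rule int[OF continuous_on_scaled[OF k(1) r] h])
  have ij: "integrable \<mu> (\<lambda>z. j (r *\<^sub>R z))"
    using int[OF continuous_on_scaled[OF j(1) r], of "\<lambda>_. 1"] by simp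
  have "Re (ip k k) = (\<integral>z. Re (k (r *\<^sub>R z)) * h z \<partial>\<mu>)"
    using k(2)[OF k(1)] Re_mult[OF ik] by simp
  also have "\<dots> \<le> (\<integral>z. Re (j (r *\<^sub>R z)) \<partial>\<mu>)"
  proof (rule integral_mono)
    show "integrable \<mu> (\<lambda>z. Re (k (r *\<^sub>R z)) * h z)"
      using integrable_Re[OF ik] by simp
    show "Re (k (r *\<^sub>R z)) * h z \<le> Re (j (r *\<^sub>R z))" if "z \<in> space \<mu>" for z
    proof -
      have "Re (k (r *\<^sub>R z)) * h z \<le> \<bar>Re (k (r *\<^sub>R z))\<bar> * \<bar>h z\<bar>"
        using abs_ge_self[of "Re (k (r *\<^sub>R z)) * h z"] by (simp add: abs_mult)
      also have "\<dots> \<le> \<bar>Re (k (r *\<^sub>R z))\<bar> * 1"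
        using h(2)[of z] by (intro mult_left_mono) auto
      finally show ?thesis using le[of z] that space by simp
    qed
  qed (rule integrable_Re[OF ij])
  also have "\<dots> = Re (\<integral>z. j (r *\<^sub>R z) \<partial>\<mu>)"
    using ij by (rule integral_Re)
  also have "\<dots> = radial_energy r \<mu>"
    using j(2) space unfolding radial_energy_def
    by (intro arg_cong[of _ _ Re] Bochner_Integration.integral_cong) auto
  finally show thesis using that[OF k] by simp
qed

lemma pairing_bound:
  assumes \<mu>: "finite_measure \<mu>" "sets \<mu> = sets sphere_borel" and r: "0 \<le> r" "r < 1"
    and h: "h \<in> borel_measurable \<mu>" "\<And>x. \<bar>h x\<bar> \<le> (1 :: real)" and f: "f \<in> H"
  shows "cmod (\<integral>\<zeta>. f (r *\<^sub>R \<zeta>) * h \<zeta> \<partial>\<mu>) \<le> ip_norm ip f * sqrt (radial_energy r \<mu>)"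
proof -
  obtain k where k: "k \<in> H" "ip f k = (\<integral>\<zeta>. f (r *\<^sub>R \<zeta>) * h \<zeta> \<partial>\<mu>)"
    and e: "Re (ip k k) \<le> radial_energy r \<mu>"
    by (rule weighted_potential[OF \<mu> r h]) (rule that, use f in auto)
  have "cmod (ip f k) \<le> ip_norm ip f * sqrt (Re (ip k k))"
    using Cauchy_Schwarz[OF f k(1)] by (simp add: ip_norm_def)
  also have "\<dots> \<le> ip_norm ip f * sqrt (radial_energy r \<mu>)"
    using e by (intro mult_left_mono ip_norm_nonneg f) auto
  finally show ?thesis using k(2) by simp
qed

text \<open>Testing against the sign of \<open>Re f\<close> and of \<open>Im f\<close>; the non-negativity of \<open>Re K\<close> is what
  makes the energy of the signed measure no larger than that of \<open>\<mu>\<close>.\<close>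

lemma integral_cmod_bound:
  assumes \<mu>: "finite_measure \<mu>" "sets \<mu> = sets sphere_borel" and r: "0 \<le> r" "r < 1"
    and f: "f \<in> H"
  shows "integrable \<mu> (\<lambda>\<zeta>. cmod (f (r *\<^sub>R \<zeta>)))"
    and "(\<integral>\<zeta>. cmod (f (r *\<^sub>R \<zeta>)) \<partial>\<mu>) \<le> 2 * ip_norm ip f * sqrt (radial_energy r \<mu>)"
proof -
  interpret finite_measure \<mu> by fact
  have space: "space \<mu> = sphere 0 1"
    using sets_eq_imp_space_eq[OF \<mu>(2)] by simp
  let ?f = "\<lambda>\<zeta>. f (r *\<^sub>R \<zeta>)"
  have cont: "continuous_on (sphere 0 1) ?f"
    by (rule continuous_on_scaled[OF f r])
  have meas: "?f \<in> borel_measurable \<mu>"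
    using borel_measurable_sphere[OF cont] \<mu>(2) by (simp cong: measurable_cong_sets)
  have "bounded (?f ` sphere 0 1)"
    by (intro compact_imp_bounded compact_continuous_image cont) simp
  then obtain C where C: "\<And>x. x \<in> sphere 0 1 \<Longrightarrow> cmod (?f x) \<le> C"
    unfolding bounded_iff by fast
  have int: "integrable \<mu> ?f"
    using meas C space by (intro integrable_const_bound[of _ C]) auto
  then show "integrable \<mu> (\<lambda>\<zeta>. cmod (?f \<zeta>))"
    by (rule integrable_norm)
  \<comment> \<open>Here \<open>p\<close> stands for \<open>Re\<close> or \<open>Im\<close>: the
    sign of \<open>p\<close> is a real weight, as \<open>pairing_bound\<close> requires. Adding the
    two cases gives the factor 2.\<close>
  have bound: "(\<integral>\<zeta>. \<bar>p (?f \<zeta>)\<bar> \<partial>\<mu>) \<le> ip_norm ip f * sqrt (radial_energy r \<mu>)"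
    if p: "bounded_linear p" "\<And>z c. p (z * complex_of_real c) = p z * c" "\<And>z. \<bar>p z\<bar> \<le> cmod z"
    for p :: "complex \<Rightarrow> real"
  proof -
    have pm: "(\<lambda>\<zeta>. sgn (p (?f \<zeta>))) \<in> borel_measurable \<mu>"
      using meas borel_measurable_continuous_onI[OF linear_continuous_on[OF p(1)]] by measurable
    have s: "\<bar>sgn x\<bar> \<le> 1" for x :: real by (simp add: sgn_if)
    have i: "integrable \<mu> (\<lambda>\<zeta>. ?f \<zeta> * of_real (sgn (p (?f \<zeta>))))"
      by (rule Bochner_Integration.integrable_bound[OF int])
        (use meas pm in \<open>auto simp: norm_mult sgn_if\<close>)
    have "(\<integral>\<zeta>. \<bar>p (?f \<zeta>)\<bar> \<partial>\<mu>) = (\<integral>\<zeta>. p (?f \<zeta> * of_real (sgn (p (?f \<zeta>)))) \<partial>\<mu>)"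
      by (simp add: p(2) abs_sgn)
    also have "\<dots> = p (\<integral>\<zeta>. ?f \<zeta> * of_real (sgn (p (?f \<zeta>))) \<partial>\<mu>)"
      by (rule integral_bounded_linear[OF p(1) i])
    also have "\<dots> \<le> cmod (\<integral>\<zeta>. ?f \<zeta> * of_real (sgn (p (?f \<zeta>))) \<partial>\<mu>)"
      using p(3) abs_ge_self order_trans by blast
    also have "\<dots> \<le> ip_norm ip f * sqrt (radial_energy r \<mu>)"
      by (rule pairing_bound[OF \<mu> r pm s f])
    finally show ?thesis .
  qed
  have "(\<integral>\<zeta>. cmod (?f \<zeta>) \<partial>\<mu>) \<le> (\<integral>\<zeta>. \<bar>Re (?f \<zeta>)\<bar> + \<bar>Im (?f \<zeta>)\<bar> \<partial>\<mu>)"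
    using int by (intro integral_mono cmod_le) auto
  also have "\<dots> = (\<integral>\<zeta>. \<bar>Re (?f \<zeta>)\<bar> \<partial>\<mu>) + (\<integral>\<zeta>. \<bar>Im (?f \<zeta>)\<bar> \<partial>\<mu>)"
    using int by (intro Bochner_Integration.integral_add) auto
  also have "\<dots> \<le> 2 * ip_norm ip f * sqrt (radial_energy r \<mu>)"
    using bound[OF bounded_linear_Re] bound[OF bounded_linear_Im] abs_Re_le_cmod abs_Im_le_cmod
    by simp
  finally show "(\<integral>\<zeta>. cmod (?f \<zeta>) \<partial>\<mu>) \<le> 2 * ip_norm ip f * sqrt (radial_energy r \<mu>)" .
qed

lemma energy_eq: "energy K \<mu> = (SUP r\<in>{0..<1}. ennreal (radial_energy r \<mu>))"
  by (simp add: energy_def radial_energy_def)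

text \<open>At r = 0 the integrand is K(0,0) = 1. This makes it safe to divide by energies.\<close>

lemma energy_ge_1: "prob_space \<mu> \<Longrightarrow> 1 \<le> energy K \<mu>"
  unfolding energy_eq
  by (rule SUP_upper2[of 0]) (simp_all add: radial_energy_def kernel_zero prob_space.prob_space)

lemma radial_energy_le:
  assumes "energy K \<mu> < \<infinity>" "0 \<le> r" "r < 1"
  shows "radial_energy r \<mu> \<le> enn2real (energy K \<mu>)"
proof -
  have "ennreal (radial_energy r \<mu>) \<le> energy K \<mu>"
    unfolding energy_eq using assms by (intro SUP_upper) auto
  also have "\<dots> = ennreal (enn2real (energy K \<mu>))"
    using assms by simp
  finally show ?thesis by (subst (asm) ennreal_le_iff) auto
qed

text \<open>This turns an arbitrary measure of finite energy into a competitor for the capacity of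
  \<open>B\<close>. The measure \<nu> is the normalised restriction; restricting does not increase
  the energy by \<open>weighted_potential\<close> with an indicator as weight.\<close>

lemma energy_restrict:
  assumes \<mu>: "\<mu> \<in> sphere_probs (sphere 0 1)" and fin: "energy K \<mu> < \<infinity>"
    and B: "B \<in> sets sphere_borel" and m: "0 < measure \<mu> B"
  obtains \<nu> where "\<nu> \<in> sphere_probs B"
    "energy K \<nu> \<le> ennreal (enn2real (energy K \<mu>) / (measure \<mu> B)\<^sup>2)"
proof -
  interpret prob_space \<mu> using \<mu> by (simp add: sphere_probs_def)
  have sets: "sets \<mu> = sets sphere_borel" using \<mu> by (simp add: sphere_probs_def)
  have space: "space \<mu> = sphere 0 1"
    using sets_eq_imp_space_eq[OF sets] by simp
  define m where "m = measure \<mu> B"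
  have mpos: "m > 0" using m by (simp add: m_def)
  define c where "c x = indicator B x / m" for x
  define \<nu> where "\<nu> = density \<mu> (\<lambda>x. ennreal (c x))"
  have B\<mu>: "B \<in> sets \<mu>" using B sets by simp
  have c_meas [measurable]: "c \<in> borel_measurable \<mu>"
    unfolding c_def using B\<mu> by simp
  have c_meas': "(\<lambda>x. ennreal (c x)) \<in> borel_measurable \<mu>"
    by measurable
  have c_eq: "c x = (if x \<in> B then 1 / m else 0)" for x
    by (simp add: c_def)
  have c_nonneg: "0 \<le> c x" for x using mpos by (simp add: c_def)
  have em: "emeasure \<nu> A = ennreal (measure \<mu> (A \<inter> B) / m)" if A: "A \<in> sets \<mu>" for A
  proof -
    have "emeasure \<nu> A = (\<integral>\<^sup>+ x. ennreal (1 / m) * indicator (A \<inter> B) x \<partial>\<mu>)"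
      unfolding \<nu>_def using A
      by (subst emeasure_density[OF c_meas']) (auto intro!: nn_integral_cong simp: c_eq split: split_indicator)
    also have "\<dots> = ennreal (1 / m) * emeasure \<mu> (A \<inter> B)"
      using A B\<mu> by (intro nn_integral_cmult_indicator) auto
    finally show ?thesis
      using mpos by (simp add: emeasure_eq_measure flip: ennreal_mult'')
  qed
  have sets\<nu>: "sets \<nu> = sets sphere_borel" and space\<nu>: "space \<nu> = space \<mu>"
    by (simp_all add: \<nu>_def sets)
  have "space \<mu> \<inter> B = B" using sets.sets_into_space[OF B\<mu>] by auto
  then have "prob_space \<nu>"
    using em[of "space \<mu>"] mpos space\<nu> by (intro prob_spaceI) (simp add: m_def)
  moreover have "emeasure \<nu> (sphere 0 1 - B) = 0"
    using em[OF sets.compl_sets[OF B\<mu>]] by (simp add: space Int_commute)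
  ultimately have \<nu>: "\<nu> \<in> sphere_probs B"
    using sets\<nu> by (simp add: sphere_probs_def)
  have "radial_energy r \<nu> \<le> enn2real (energy K \<mu>) / m\<^sup>2" if r: "0 \<le> r" "r < 1" for r
  proof -
    have hB: "\<bar>indicator B x\<bar> \<le> (1 :: real)" for x by (simp add: indicator_def)
    obtain k where k: "k \<in> H" "\<And>f. f \<in> H \<Longrightarrow> ip f k = (\<integral>\<zeta>. f (r *\<^sub>R \<zeta>) * of_real (indicator B \<zeta>) \<partial>\<mu>)"
      "\<And>z. z \<in> sphere 0 1 \<Longrightarrow> k (r *\<^sub>R z) = (\<integral>w. K (r *\<^sub>R z) (r *\<^sub>R w) * of_real (indicator B w) \<partial>\<mu>)"
      "Re (ip k k) \<le> radial_energy r \<mu>"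
      by (rule weighted_potential[OF finite_measure_axioms sets r borel_measurable_indicator[OF B\<mu>] hB])
        (rule that)
    have cont: "f \<in> borel_measurable \<mu>" if "continuous_on (sphere 0 1) f" for f :: "_ \<Rightarrow> complex"
      using borel_measurable_sphere[OF that] sets by (simp cong: measurable_cong_sets)
    have int: "(\<integral>x. f x \<partial>\<nu>) = (\<integral>x. f x * of_real (indicator B x) \<partial>\<mu>) / of_real m"
      if f: "f \<in> borel_measurable \<mu>" for f :: "_ \<Rightarrow> complex"
    proof -
      have "(\<integral>x. f x \<partial>\<nu>) = (\<integral>x. c x *\<^sub>R f x \<partial>\<mu>)"
        unfolding \<nu>_def using f c_nonneg by (intro integral_density) auto
      also have "\<dots> = (\<integral>x. (f x * of_real (indicator B x)) / of_real m \<partial>\<mu>)"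
        by (intro Bochner_Integration.integral_cong) (auto simp: c_def scaleR_conv_of_real)
      finally show ?thesis by simp
    qed
    \<comment> \<open>Each of the two integrations contributes one factor 1/m, hence the square in
      the bound.\<close>
    have inner: "(\<integral>w. K (r *\<^sub>R z) (r *\<^sub>R w) \<partial>\<nu>) = k (r *\<^sub>R z) / of_real m" if z: "z \<in> sphere 0 1" for z
      using int[OF cont[OF continuous_on_kernel_slice[OF r z]]] k(3)[OF z] by simp
    have "(\<integral>z. (\<integral>w. K (r *\<^sub>R z) (r *\<^sub>R w) \<partial>\<nu>) \<partial>\<nu>) = (\<integral>z. k (r *\<^sub>R z) / of_real m \<partial>\<nu>)"
      using inner space\<nu> space by (intro Bochner_Integration.integral_cong) auto
    also have "\<dots> = ip k k / of_real m / of_real m"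
      using int[OF cont[OF continuous_on_scaled[OF k(1) r]]] k(2)[OF k(1)] by simp
    finally have "radial_energy r \<nu> = Re (ip k k) / m\<^sup>2"
      by (simp add: radial_energy_def power2_eq_square flip: of_real_mult)
    then show ?thesis
      using k(4) radial_energy_le[OF fin r] mpos by (simp add: divide_right_mono)
  qed
  then have "energy K \<nu> \<le> ennreal (enn2real (energy K \<mu>) / m\<^sup>2)"
    unfolding energy_eq by (intro SUP_least ennreal_leI) auto
  then show thesis using that \<nu> by (simp add: m_def)
qed

end

section \<open>Countable subadditivity and the capacitary weak-type inequality\<close>

lemma one_divide_ennreal: "0 < e \<Longrightarrow> 1 / ennreal e = ennreal (1 / e)"
  using divide_ennreal[of 1 e] by simp

context nonneg_kernel_space
begin

section \<open>Capacity of open sets in terms of all measures of finite energy\<close>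

lemma sphere_probs_mono: "F \<in> sets sphere_borel \<Longrightarrow> \<mu> \<in> sphere_probs F \<Longrightarrow> \<mu> \<in> sphere_probs (sphere 0 1)"
  by (simp add: sphere_probs_def)

text \<open>The square root of the capacity, characterised through all measures of finite energy.
  Unlike the capacity itself, this bound is easily seen to be countably subadditive.\<close>

definition cap_bound :: "(complex ^ 'd) set \<Rightarrow> real \<Rightarrow> bool" where
  "cap_bound G \<delta> \<longleftrightarrow> (\<forall>\<mu>\<in>sphere_probs (sphere 0 1). energy K \<mu> < \<infinity> \<longrightarrow>
     measure \<mu> G \<le> \<delta> * sqrt (enn2real (energy K \<mu>)))"

lemma enn2real_energy:
  assumes "prob_space \<mu>" "energy K \<mu> < \<infinity>"
  shows "energy K \<mu> = ennreal (enn2real (energy K \<mu>))" "1 \<le> enn2real (energy K \<mu>)"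
proof -
  show *: "energy K \<mu> = ennreal (enn2real (energy K \<mu>))"
    using assms(2) by simp
  have "1 \<le> ennreal (enn2real (energy K \<mu>))"
    using energy_ge_1[OF assms(1)] * by simp
  then show "1 \<le> enn2real (energy K \<mu>)"
    by simp
qed

text \<open>A competitor for a compact subset of \<open>G\<close> gives \<open>G\<close> mass one,
  so the bound reads 1 \<le> \<delta> sqrt(E), that is 1/E \<le> \<delta>^2. Measures of infinite
  energy E contribute 0.\<close>

lemma inner_cap_le:
  assumes G: "G \<in> sets sphere_borel" and \<delta>: "0 \<le> \<delta>" and bound: "cap_bound G \<delta>"
  shows "inner_cap K G \<le> ennreal (\<delta>\<^sup>2)"
  unfolding inner_cap_def compact_cap_def
proof (intro SUP_least)
  fix F \<mu> assume "F \<in> {F. compact F \<and> F \<subseteq> G}" and \<mu>: "\<mu> \<in> sphere_probs F"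
  then have F: "compact F" "F \<subseteq> G" by auto
  interpret prob_space \<mu> using \<mu> by (simp add: sphere_probs_def)
  have sets: "sets \<mu> = sets sphere_borel" using \<mu> by (simp add: sphere_probs_def)
  have space: "space \<mu> = sphere 0 1"
    using sets_eq_imp_space_eq[OF sets] by simp
  have GF: "G \<subseteq> sphere 0 1"
    using sets.sets_into_space[OF G] by simp
  have F\<mu>: "F \<in> sets sphere_borel"
    using F GF by (intro sets_sphere_borel_closed compact_imp_closed) auto
  show "1 / energy K \<mu> \<le> ennreal (\<delta>\<^sup>2)"
  proof (cases "energy K \<mu> < \<infinity>")
    case True
    note e = enn2real_energy[OF prob_space_axioms True]
    have "prob (space \<mu> - F) = 0"
      using \<mu> space by (simp add: sphere_probs_def measure_def)
    then have "prob F = 1"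
      using prob_compl[of F] F\<mu> sets by simp
    then have "1 \<le> prob G"
      using finite_measure_mono[of F G] F G sets by simp
    also have "prob G \<le> \<delta> * sqrt (enn2real (energy K \<mu>))"
      using bound True sphere_probs_mono[OF F\<mu> \<mu>] by (simp add: cap_bound_def)
    finally have "1 \<le> (\<delta> * sqrt (enn2real (energy K \<mu>)))\<^sup>2"
      by (simp add: one_le_power)
    then have "1 / enn2real (energy K \<mu>) \<le> \<delta>\<^sup>2"
      using e(2) by (simp add: power_mult_distrib field_simps)
    then show ?thesis
      using e(2) by (subst e(1)) (simp add: one_divide_ennreal ennreal_leI)
  qed (simp add: less_top[symmetric])
qed

text \<open>For compact \<open>F\<close> inside \<open>G\<close>, the restriction from
  \<open>energy_restrict\<close> competes in the capacity of \<open>G\<close>, whence \<mu>(F)^2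
  \<le> \<delta>^2 E(\<mu>). Exhausting \<open>G\<close> by compact sets gives the claim.\<close>

lemma cap_bound_of_inner_cap:
  assumes G: "openin (top_of_set (sphere 0 1)) G" and \<delta>: "0 \<le> \<delta>"
    and cap: "inner_cap K G \<le> ennreal (\<delta>\<^sup>2)"
  shows "cap_bound G \<delta>"
  unfolding cap_bound_def
proof (intro ballI impI)
  fix \<mu> assume \<mu>: "\<mu> \<in> sphere_probs (sphere 0 1)" and fin: "energy K \<mu> < \<infinity>"
  interpret prob_space \<mu> using \<mu> by (simp add: sphere_probs_def)
  have sets: "sets \<mu> = sets sphere_borel" using \<mu> by (simp add: sphere_probs_def)
  define e where "e = enn2real (energy K \<mu>)"
  note e = enn2real_energy[OF prob_space_axioms fin, folded e_def]
  have compact: "prob F \<le> \<delta> * sqrt e" if F: "compact F" "F \<subseteq> G" for F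
  proof (cases "prob F = 0")
    case True
    then show ?thesis using \<delta> e(2) by simp
  next
    case False
    then have m: "0 < prob F" by (simp add: zero_less_measure_iff)
    have "F \<subseteq> sphere 0 1" using F G openin_imp_subset by blast
    then have F\<mu>: "F \<in> sets sphere_borel"
      using F by (intro sets_sphere_borel_closed compact_imp_closed)
    obtain \<nu> where \<nu>: "\<nu> \<in> sphere_probs F" "energy K \<nu> \<le> ennreal (e / (prob F)\<^sup>2)"
      using energy_restrict[OF \<mu> fin F\<mu> m] unfolding e_def by blast
    have \<nu>p: "prob_space \<nu>" using \<nu>(1) by (simp add: sphere_probs_def)
    have \<nu>fin: "energy K \<nu> < \<infinity>"
      using \<nu>(2) by (simp add: le_less_trans)
    define e' where "e' = enn2real (energy K \<nu>)"
    note e' = enn2real_energy[OF \<nu>p \<nu>fin, folded e'_def]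
    have e'_le: "e' \<le> e / (prob F)\<^sup>2"
      using \<nu>(2) e' e(2) by (simp add: ennreal_le_iff)
    have "1 / energy K \<nu> \<le> inner_cap K G"
      unfolding inner_cap_def compact_cap_def using F \<nu>(1) by (intro SUP_upper2[of F] SUP_upper2[of \<nu>]) auto
    also have "\<dots> \<le> ennreal (\<delta>\<^sup>2)" by (rule cap)
    finally have "ennreal (1 / e') \<le> ennreal (\<delta>\<^sup>2)"
      using one_divide_ennreal[of e'] e'(2) by (simp flip: e'(1))
    then have "1 / e' \<le> \<delta>\<^sup>2" by (simp add: ennreal_le_iff)
    then have "1 \<le> \<delta>\<^sup>2 * e'" using e'(2) by (simp add: field_simps)
    also have "\<dots> \<le> \<delta>\<^sup>2 * (e / (prob F)\<^sup>2)"
      using e'_le by (intro mult_left_mono) auto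
    finally have "(prob F)\<^sup>2 \<le> \<delta>\<^sup>2 * e"
      using m by (simp add: field_simps)
    then have "(prob F)\<^sup>2 \<le> (\<delta> * sqrt e)\<^sup>2"
      using e(2) by (simp add: power_mult_distrib)
    then show ?thesis
      by (rule power2_le_imp_le) (use \<delta> e(2) in simp)
  qed
  \<comment> \<open>A relatively open subset of the sphere is an increasing union of compact sets,
    and \<mu> is continuous from below.\<close>
  obtain T where T: "open T" "G = sphere 0 1 \<inter> T"
    using G by (auto simp: openin_open)
  obtain C where C: "\<And>n :: nat. compact (C n)" "\<And>n. C n \<subseteq> interior (C (Suc n))" "\<Union>(range C) = T"
    by (rule open_Union_compact_subsets[OF T(1)]) (rule that)
  define D where "D n = sphere 0 1 \<inter> C n" for n
  have D: "compact (D n)" "D n \<subseteq> G" for n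
    using C(1,3) T(2) by (auto simp: D_def compact_Int)
  have "incseq D"
    using C(2) interior_subset by (intro incseq_SucI) (fastforce simp: D_def)
  moreover have "range D \<subseteq> events"
    using D(1) by (auto simp: sets D_def intro!: sets_sphere_borel_closed compact_imp_closed)
  moreover have "(\<Union>n. D n) = G"
    using C(3) T(2) by (auto simp: D_def)
  ultimately have "(\<lambda>n. prob (D n)) \<longlonglongrightarrow> prob G"
    using finite_Lim_measure_incseq[of D] by simp
  then show "prob G \<le> \<delta> * sqrt (enn2real (energy K \<mu>))"
    unfolding e_def[symmetric] using compact[OF D] by (intro LIMSEQ_le_const2) auto
qed

text \<open>Up to strictness of the inequality this says that the outer capacity is at most
  \<delta>^2: the infimum over open sets need not be attained, so the converse
  \<open>cap_small_of_outer_cap\<close> starts from a strict bound.\<close>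

definition cap_small :: "(complex ^ 'd) set \<Rightarrow> real \<Rightarrow> bool" where
  "cap_small E \<delta> \<longleftrightarrow> 0 \<le> \<delta> \<and>
     (\<exists>G. openin (top_of_set (sphere 0 1)) G \<and> E \<subseteq> G \<and> cap_bound G \<delta>)"

lemma outer_cap_le:
  assumes "cap_small E \<delta>"
  shows "outer_cap K E \<le> ennreal (\<delta>\<^sup>2)"
proof -
  obtain G where G: "openin (top_of_set (sphere 0 1)) G" "E \<subseteq> G" "cap_bound G \<delta>"
    using assms by (auto simp: cap_small_def)
  have "outer_cap K E \<le> inner_cap K G"
    unfolding outer_cap_def using G by (intro INF_lower) auto
  also have "\<dots> \<le> ennreal (\<delta>\<^sup>2)"
    using G assms by (intro inner_cap_le sets_sphere_borel_openin) (auto simp: cap_small_def)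
  finally show ?thesis .
qed

lemma cap_small_of_outer_cap:
  assumes "outer_cap K E < ennreal (\<delta>\<^sup>2)" "0 \<le> \<delta>"
  shows "cap_small E \<delta>"
proof -
  obtain G where "openin (top_of_set (sphere 0 1)) G" "E \<subseteq> G" "inner_cap K G < ennreal (\<delta>\<^sup>2)"
    using assms(1) by (auto simp: outer_cap_def INF_less_iff)
  then show ?thesis
    unfolding cap_small_def using assms(2) cap_bound_of_inner_cap less_imp_le by blast
qed

lemma cap_small_mono:
  assumes "cap_small E \<delta>" "E' \<subseteq> E"
  shows "cap_small E' \<delta>"
  using assms unfolding cap_small_def by blast

text \<open>For each fixed \<mu> the parameter \<delta> bounds \<mu>(G) linearly, so the parameters
  add because \<mu> is countably subadditive.\<close>

lemma cap_small_UN: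
  fixes E :: "nat \<Rightarrow> (complex ^ 'd) set"
  assumes E: "\<And>n. cap_small (E n) (\<delta> n)" and s: "summable \<delta>"
  shows "cap_small (\<Union>n. E n) (suminf \<delta>)"
proof -
  have "\<forall>n. \<exists>G. openin (top_of_set (sphere 0 1)) G \<and> E n \<subseteq> G \<and> cap_bound G (\<delta> n)"
    using E by (simp add: cap_small_def)
  from choice[OF this] obtain G where
    G: "\<And>n. openin (top_of_set (sphere 0 1)) (G n)" "\<And>n. E n \<subseteq> G n" "\<And>n. cap_bound (G n) (\<delta> n)"
    by blast
  have "cap_bound (\<Union>n. G n) (suminf \<delta>)"
    unfolding cap_bound_def
  proof (intro ballI impI)
    fix \<mu> assume \<mu>: "\<mu> \<in> sphere_probs (sphere 0 1)" and fin: "energy K \<mu> < \<infinity>"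
    interpret prob_space \<mu> using \<mu> by (simp add: sphere_probs_def)
    have sets: "sets \<mu> = sets sphere_borel" using \<mu> by (simp add: sphere_probs_def)
    let ?e = "sqrt (enn2real (energy K \<mu>))"
    have le: "prob (G n) \<le> \<delta> n * ?e" for n
      using G(3) \<mu> fin by (simp add: cap_bound_def)
    have s': "summable (\<lambda>n. \<delta> n * ?e)"
      using s by (rule summable_mult2)
    have s'': "summable (\<lambda>n. prob (G n))"
      by (rule summable_comparison_test'[OF s']) (simp add: le)
    have "prob (\<Union>n. G n) \<le> (\<Sum>n. prob (G n))"
      using sets_sphere_borel_openin[OF G(1)] sets s''
      by (intro finite_measure_subadditive_countably) auto
    also have "\<dots> \<le> (\<Sum>n. \<delta> n * ?e)"
      using le s'' s' by (rule suminf_le)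
    also have "\<dots> = suminf \<delta> * ?e"
      using suminf_mult2[OF s] by simp
    finally show "prob (\<Union>n. G n) \<le> suminf \<delta> * ?e" .
  qed
  moreover have "0 \<le> suminf \<delta>"
    using E s by (intro suminf_nonneg) (auto simp: cap_small_def)
  moreover have "openin (top_of_set (sphere 0 1)) (\<Union>n. G n)"
    using G(1) by (intro openin_Union) auto
  ultimately show ?thesis
    unfolding cap_small_def using G(2) by blast
qed

lemma cap_small_empty: "cap_small {} 0"
  by (auto simp: cap_small_def cap_bound_def)

lemma cap_small_Un:
  assumes "cap_small A a" "cap_small B b"
  shows "cap_small (A \<union> B) (a + b)"
proof -
  \<comment> \<open>The pair is padded to a sequence by empty sets, which cost 0.\<close>
  define E where "E n = (if n = 0 then A else if n = 1 then B else {})" for n :: nat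
  define \<delta> where "\<delta> n = (if n = 0 then a else if n = 1 then b else 0)" for n :: nat
  have "\<delta> sums (\<Sum>n\<in>{0,1}. \<delta> n)"
    by (intro sums_finite) (auto simp: \<delta>_def)
  then have s: "\<delta> sums (a + b)" by (simp add: \<delta>_def)
  have "cap_small (\<Union>n. E n) (suminf \<delta>)"
    using assms cap_small_empty sums_summable[OF s] by (intro cap_small_UN) (auto simp: E_def \<delta>_def)
  moreover have "A \<union> B = E 0 \<union> E 1"
    by (simp add: E_def)
  then have "A \<union> B \<subseteq> (\<Union>n. E n)"
    by blast
  ultimately show ?thesis
    using s cap_small_mono by (simp add: sums_iff)
qed

lemma outer_cap_0I:
  assumes "\<And>\<delta>. 0 < \<delta> \<Longrightarrow> cap_small E \<delta>"
  shows "outer_cap K E = 0"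
proof -
  have *: "outer_cap K E \<le> ennreal e" if "0 < e" for e
    using outer_cap_le[OF assms[of "sqrt e"]] that by simp
  have "outer_cap K E \<le> 0"
    by (rule ennreal_le_epsilon) (simp add: *)
  then show ?thesis by simp
qed

text \<open>Chebyshev's inequality for each \<mu>, with the integral bound uniform in r. The strict
  level set at height t/2 serves as open neighbourhood, which doubles the constant 2 to 4.\<close>

lemma cap_small_levelset:
  assumes f: "f \<in> H" and r: "0 \<le> r" "r < 1" and t: "0 < t"
  shows "cap_small {\<zeta> \<in> sphere 0 1. t \<le> cmod (f (r *\<^sub>R \<zeta>))} (4 * ip_norm ip f / t)"
proof -
  define G where "G = {\<zeta> \<in> sphere 0 1. t / 2 < cmod (f (r *\<^sub>R \<zeta>))}"
  have "continuous_on (sphere 0 1) (\<lambda>\<zeta>. cmod (f (r *\<^sub>R \<zeta>)))"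
    by (intro continuous_intros continuous_on_scaled f r)
  then have "openin (top_of_set (sphere 0 1)) (sphere 0 1 \<inter> (\<lambda>\<zeta>. cmod (f (r *\<^sub>R \<zeta>))) -` {t / 2<..})"
    by (rule continuous_openin_preimage_gen) simp
  also have "sphere 0 1 \<inter> (\<lambda>\<zeta>. cmod (f (r *\<^sub>R \<zeta>))) -` {t / 2<..} = G"
    by (auto simp: G_def)
  finally have G: "openin (top_of_set (sphere 0 1)) G" .
  have "cap_bound G (4 * ip_norm ip f / t)"
    unfolding cap_bound_def
  proof (intro ballI impI)
    fix \<mu> assume \<mu>: "\<mu> \<in> sphere_probs (sphere 0 1)" and fin: "energy K \<mu> < \<infinity>"
    interpret prob_space \<mu> using \<mu> by (simp add: sphere_probs_def)
    have sets: "sets \<mu> = sets sphere_borel" using \<mu> by (simp add: sphere_probs_def)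
    have space: "space \<mu> = sphere 0 1"
      using sets_eq_imp_space_eq[OF sets] by simp
    have GE: "G \<in> events"
      using sets_sphere_borel_openin[OF G] sets by simp
    let ?e = "sqrt (enn2real (energy K \<mu>))"
    note bound = integral_cmod_bound[OF finite_measure_axioms sets r f]
    have "t / 2 * prob G = (\<integral>\<zeta>. t / 2 * indicator G \<zeta> \<partial>\<mu>)"
      using GE by simp
    also have "\<dots> \<le> (\<integral>\<zeta>. cmod (f (r *\<^sub>R \<zeta>)) \<partial>\<mu>)"
      using GE bound(1) by (intro integral_mono integrable_mult_right)
        (auto simp: G_def less_top[symmetric] split: split_indicator)
    also have "\<dots> \<le> 2 * ip_norm ip f * sqrt (radial_energy r \<mu>)"
      by (rule bound(2))
    also have "\<dots> \<le> 2 * ip_norm ip f * ?e"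
      using radial_energy_le[OF fin r] ip_norm_nonneg[OF f] by (intro mult_left_mono) auto
    finally show "prob G \<le> 4 * ip_norm ip f / t * ?e"
      using t by (simp add: field_simps)
  qed
  moreover have "{\<zeta> \<in> sphere 0 1. t \<le> cmod (f (r *\<^sub>R \<zeta>))} \<subseteq> G"
    using t by (auto simp: G_def)
  ultimately show ?thesis
    unfolding cap_small_def using G ip_norm_nonneg[OF f] t by auto
qed

lemma cap_small_increasing:
  assumes "cap_small E \<delta>" "\<delta> \<le> \<delta>'"
  shows "cap_small E \<delta>'"
proof -
  have "cap_bound G \<delta>'" if "cap_bound G \<delta>" for G
    unfolding cap_bound_def
  proof (intro ballI impI)
    fix \<mu> assume "\<mu> \<in> sphere_probs (sphere 0 1)" "energy K \<mu> < \<infinity>"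
    then have "measure \<mu> G \<le> \<delta> * sqrt (enn2real (energy K \<mu>))"
      using that by (simp add: cap_bound_def)
    also have "\<dots> \<le> \<delta>' * sqrt (enn2real (energy K \<mu>))"
      using assms(2) by (intro mult_right_mono) auto
    finally show "measure \<mu> G \<le> \<delta>' * sqrt (enn2real (energy K \<mu>))" .
  qed
  moreover have "0 \<le> \<delta>'"
    using assms by (simp add: cap_small_def)
  ultimately show ?thesis
    using assms(1) unfolding cap_small_def by blast
qed

text \<open>The uniformly continuous part \<open>p\<close> moves by less than e/3 once the radii are
  close. The remainder \<open>g\<close> is small in norm, so each of its two dilates stays below e/3
  off a set of small capacity, at any radius.\<close>

lemma radial_Cauchy_in_capacity:
  assumes f: "f \<in> H" and e: "0 < e" and \<delta>: "0 < \<delta>"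
  obtains a where "0 \<le> a" "a < 1" "\<And>r s. a < r \<Longrightarrow> r < 1 \<Longrightarrow> a < s \<Longrightarrow> s < 1 \<Longrightarrow>
    cap_small {\<zeta> \<in> sphere 0 1. e \<le> cmod (f (r *\<^sub>R \<zeta>) - f (s *\<^sub>R \<zeta>))} \<delta>"
proof -
  \<comment> \<open>The constant 24: two level sets of height e/3, each of size 4 / (e/3) = 12/e
    times the norm.\<close>
  obtain p where p: "p \<in> H" "uniformly_continuous_on (ball 0 1) p"
    and fp: "ip_norm ip (\<lambda>x. f x - p x) < \<delta> * e / 24"
    using dense_uniformly_continuous[OF f, of "\<delta> * e / 24"] e \<delta> by auto
  define g where "g = (\<lambda>x. f x - p x)"
  have g: "g \<in> H" unfolding g_def by (rule diff_mem[OF f p(1)])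
  have e3: "0 < e / 3" using e by simp
  obtain d where d: "0 < d" "\<And>x y. x \<in> ball 0 1 \<Longrightarrow> y \<in> ball 0 1 \<Longrightarrow> dist y x < d \<Longrightarrow> dist (p y) (p x) < e / 3"
    by (rule uniformly_continuous_onE[OF p(2) e3]) (rule that)
  \<comment> \<open>Two radii between \<open>a\<close> and 1 differ by less than
    \<open>d\<close>.\<close>
  define a where "a = max 0 (1 - d)"
  have "cap_small {\<zeta> \<in> sphere 0 1. e \<le> cmod (f (r *\<^sub>R \<zeta>) - f (s *\<^sub>R \<zeta>))} \<delta>"
    if r: "a < r" "r < 1" and s: "a < s" "s < 1" for r s
  proof -
    have rs: "0 \<le> r" "0 \<le> s" "\<bar>r - s\<bar> < d" using r s by (auto simp: a_def)
    let ?L = "\<lambda>r. {\<zeta> \<in> sphere 0 1. e / 3 \<le> cmod (g (r *\<^sub>R \<zeta>))}"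
    have "4 * ip_norm ip g / (e / 3) + 4 * ip_norm ip g / (e / 3) \<le> \<delta>"
      using fp e by (simp add: g_def field_simps)
    then have "cap_small (?L r \<union> ?L s) \<delta>"
      using cap_small_Un[OF cap_small_levelset[OF g rs(1) r(2) e3] cap_small_levelset[OF g rs(2) s(2) e3]]
        cap_small_increasing by blast
    moreover have "{\<zeta> \<in> sphere 0 1. e \<le> cmod (f (r *\<^sub>R \<zeta>) - f (s *\<^sub>R \<zeta>))} \<subseteq> ?L r \<union> ?L s"
    proof (rule subsetI, rule ccontr)
      fix \<zeta> assume \<zeta>: "\<zeta> \<in> {\<zeta> \<in> sphere 0 1. e \<le> cmod (f (r *\<^sub>R \<zeta>) - f (s *\<^sub>R \<zeta>))}" "\<zeta> \<notin> ?L r \<union> ?L s"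
      then have n: "norm \<zeta> = 1" and lt: "cmod (g (r *\<^sub>R \<zeta>)) < e / 3" "cmod (g (s *\<^sub>R \<zeta>)) < e / 3"
        and ge: "e \<le> cmod (f (r *\<^sub>R \<zeta>) - f (s *\<^sub>R \<zeta>))" by auto
      have "dist (r *\<^sub>R \<zeta>) (s *\<^sub>R \<zeta>) = \<bar>r - s\<bar>"
        using n by (simp add: dist_norm flip: scaleR_left_diff_distrib)
      then have "cmod (p (r *\<^sub>R \<zeta>) - p (s *\<^sub>R \<zeta>)) < e / 3"
        using d(2)[of "s *\<^sub>R \<zeta>" "r *\<^sub>R \<zeta>"] n rs r s by (simp add: dist_norm)
      moreover have "f (r *\<^sub>R \<zeta>) - f (s *\<^sub>R \<zeta>)
          = (p (r *\<^sub>R \<zeta>) - p (s *\<^sub>R \<zeta>)) + (g (r *\<^sub>R \<zeta>) - g (s *\<^sub>R \<zeta>))"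
        by (simp add: g_def)
      ultimately show False
        using ge lt norm_triangle_ineq[of "p (r *\<^sub>R \<zeta>) - p (s *\<^sub>R \<zeta>)" "g (r *\<^sub>R \<zeta>) - g (s *\<^sub>R \<zeta>)"]
          norm_triangle_ineq4[of "g (r *\<^sub>R \<zeta>)" "g (s *\<^sub>R \<zeta>)"] by simp
    qed
    ultimately show ?thesis by (rule cap_small_mono)
  qed
  then show thesis using that[of a] d(1) by (simp add: a_def)
qed

end

section \<open>Radial limits\<close>

text \<open>Increments are controlled only from index \<open>m\<close> on, as happens off the
  exceptional set \<open>T m\<close> below; the geometric tail starting at \<open>m\<close> sums to
  2 (1/2)^m.\<close>

lemma geometric_Cauchy_limit:
  fixes x :: "nat \<Rightarrow> 'a :: banach"
  assumes "\<And>n. m \<le> n \<Longrightarrow> norm (x n - x (Suc n)) \<le> (1 / 2) ^ n"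
  shows "convergent x" "norm (lim x - x m) \<le> 2 * (1 / 2) ^ m"
proof -
  define y where "y n = x (Suc n + m) - x (n + m)" for n
  have y: "norm (y n) \<le> (1 / 2) ^ m * (1 / 2) ^ n" for n
    using assms[of "n + m"] by (simp add: y_def norm_minus_commute power_add mult.commute)
  have g: "(\<lambda>n. (1 / 2 :: real) ^ m * (1 / 2) ^ n) sums ((1 / 2) ^ m * 2)"
    using geometric_sums[of "1 / 2 :: real"] by (intro sums_mult) simp
  have "(\<lambda>n. \<Sum>k<n. y k) \<longlonglongrightarrow> suminf y"
    using summable_comparison_test'[OF sums_summable[OF g] y] by (simp add: summable_LIMSEQ)
  moreover have "(\<Sum>k<n. y k) = x (n + m) - x m" for n
    using sum_lessThan_telescope[of "\<lambda>n. x (n + m)" n] by (simp add: y_def)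
  ultimately have "(\<lambda>n. x (n + m) - x m) \<longlonglongrightarrow> suminf y" by simp
  from tendsto_add[OF this tendsto_const[of "x m"]]
  have lim: "x \<longlonglongrightarrow> suminf y + x m"
    by - (rule LIMSEQ_offset[of _ m], simp)
  then show "convergent x" by (rule convergentI)
  have "norm (suminf y) \<le> (\<Sum>n. (1 / 2) ^ m * (1 / 2) ^ n)"
    by (rule norm_suminf_le[OF y sums_summable[OF g]])
  then show "norm (lim x - x m) \<le> 2 * (1 / 2) ^ m"
    using limI[OF lim] sums_unique[OF g] by simp
qed

context nonneg_kernel_space
begin

lemma converges_in_cap_iff:
  "converges_in_cap K f g \<longleftrightarrow> (\<forall>\<epsilon>>0. \<forall>\<delta>>0. \<forall>\<^sub>F r in at_left 1.
     cap_small {\<zeta> \<in> sphere 0 1. \<epsilon> \<le> cmod (g \<zeta> - f (r *\<^sub>R \<zeta>))} \<delta>)"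
  (is "?L \<longleftrightarrow> (\<forall>\<epsilon>>0. \<forall>\<delta>>0. \<forall>\<^sub>F r in at_left 1. cap_small (?E \<epsilon> r) \<delta>)")
proof (intro iffI allI impI)
  fix \<epsilon> \<delta> :: real assume L: ?L and pos: "0 < \<epsilon>" "0 < \<delta>"
  have "((\<lambda>r. outer_cap K (?E \<epsilon> r)) \<longlongrightarrow> 0) (at_left 1)"
    using L pos by (simp add: converges_in_cap_def)
  moreover have "0 < ennreal (\<delta>\<^sup>2)" using pos by simp
  ultimately have "\<forall>\<^sub>F r in at_left 1. outer_cap K (?E \<epsilon> r) < ennreal (\<delta>\<^sup>2)"
    by (rule order_tendstoD(2))
  then show "\<forall>\<^sub>F r in at_left 1. cap_small (?E \<epsilon> r) \<delta>"
    by (rule eventually_mono) (use pos cap_small_of_outer_cap in simp)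
next
  assume R: "\<forall>\<epsilon>>0. \<forall>\<delta>>0. \<forall>\<^sub>F r in at_left 1. cap_small (?E \<epsilon> r) \<delta>"
  show ?L
    unfolding converges_in_cap_def
  proof (intro allI impI order_tendstoI)
    fix \<epsilon> :: real and y :: ennreal assume "0 < \<epsilon>" "0 < y"
    \<comment> \<open>An intermediate value is finite even if \<open>y\<close> is infinite, so
      \<delta> can be its square root; it also supplies the strict inequality.\<close>
    obtain z where z: "0 < z" "z < y" using dense[OF \<open>0 < y\<close>] by blast
    define \<delta> where "\<delta> = sqrt (enn2real z)"
    have "z < \<top>" using less_le_trans[OF z(2) top_greatest] .
    then have \<delta>: "0 < \<delta>" "ennreal (\<delta>\<^sup>2) = z"
      using z by (simp_all add: \<delta>_def enn2real_positive_iff)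
    have "\<forall>\<^sub>F r in at_left 1. cap_small (?E \<epsilon> r) \<delta>"
      using R \<open>0 < \<epsilon>\<close> \<delta>(1) by blast
    then show "\<forall>\<^sub>F r in at_left 1. outer_cap K (?E \<epsilon> r) < y"
      by (rule eventually_mono) (use outer_cap_le \<delta>(2) z(2) le_less_trans in blast)
  qed simp
qed

text \<open>Where \<open>g\<close> and \<open>h\<close> differ by at least 1/(k+1), one of them is
  at distance at least half of that from any given dilate. The set does not depend on the radius, so
  letting the radius tend to 1 makes its size arbitrarily small.\<close>

lemma converges_in_cap_unique:
  assumes f: "converges_in_cap K f g" "converges_in_cap K f h"
    and meas: "g \<in> borel_measurable sphere_borel" "h \<in> borel_measurable sphere_borel"
  shows "\<exists>N \<in> sets sphere_borel. outer_cap K N = 0 \<and> (\<forall>\<zeta>\<in>sphere 0 1 - N. g \<zeta> = h \<zeta>)"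
proof -
  define N where "N = {\<zeta> \<in> space sphere_borel. g \<zeta> \<noteq> h \<zeta>}"
  have "N \<in> sets sphere_borel"
    unfolding N_def using meas by measurable
  moreover have "cap_small N \<delta>" if \<delta>: "0 < \<delta>" for \<delta>
  proof -
    let ?E = "\<lambda>k :: nat. {\<zeta> \<in> sphere 0 1. 1 / real (Suc k) \<le> cmod (g \<zeta> - h \<zeta>)}"
    have "cap_small (?E k) (\<delta> * (1 / 2) ^ Suc k)" for k
    proof -
      \<comment> \<open>Half of the gap 1/(k+1) goes to each function, and \<open>d\<close> is half
        of the k-th share of \<delta>; the shares sum to \<delta>.\<close>
      define e where "e = 1 / (2 * real (Suc k))"
      define d where "d = \<delta> * (1 / 2) ^ Suc k / 2"
      have pos: "0 < e" "0 < d" using \<delta> by (simp_all add: e_def d_def)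
      have "\<forall>\<^sub>F r in at_left 1. cap_small {\<zeta> \<in> sphere 0 1. e \<le> cmod (g \<zeta> - f (r *\<^sub>R \<zeta>))} d \<and>
          cap_small {\<zeta> \<in> sphere 0 1. e \<le> cmod (h \<zeta> - f (r *\<^sub>R \<zeta>))} d"
        using f pos by (intro eventually_conj) (simp_all add: converges_in_cap_iff)
      from eventually_happens'[OF _ this] obtain r
        where r: "cap_small {\<zeta> \<in> sphere 0 1. e \<le> cmod (g \<zeta> - f (r *\<^sub>R \<zeta>))} d"
          "cap_small {\<zeta> \<in> sphere 0 1. e \<le> cmod (h \<zeta> - f (r *\<^sub>R \<zeta>))} d"
        by auto
      have "e \<le> cmod (g \<zeta> - f (r *\<^sub>R \<zeta>)) \<or> e \<le> cmod (h \<zeta> - f (r *\<^sub>R \<zeta>))"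
        if "1 / real (Suc k) \<le> cmod (g \<zeta> - h \<zeta>)" for \<zeta>
      proof -
        have "2 * e = 1 / real (Suc k)" by (simp add: e_def field_simps)
        then show ?thesis
          using that norm_triangle_ineq4[of "g \<zeta> - f (r *\<^sub>R \<zeta>)" "h \<zeta> - f (r *\<^sub>R \<zeta>)"] by auto
      qed
      then have "?E k \<subseteq> {\<zeta> \<in> sphere 0 1. e \<le> cmod (g \<zeta> - f (r *\<^sub>R \<zeta>))} \<union>
          {\<zeta> \<in> sphere 0 1. e \<le> cmod (h \<zeta> - f (r *\<^sub>R \<zeta>))}"
        by blast
      from cap_small_mono[OF cap_small_Un[OF r] this] show ?thesis by (simp add: d_def)
    qed
    moreover have s: "(\<lambda>k. \<delta> * (1 / 2) ^ Suc k) sums \<delta>"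
      using sums_mult[OF power_half_series, of \<delta>] by simp
    ultimately have "cap_small (\<Union>k. ?E k) \<delta>"
      using cap_small_UN[OF _ sums_summable[OF s], of ?E] sums_unique[OF s] by simp
    moreover have "N \<subseteq> (\<Union>k. ?E k)"
    proof
      fix \<zeta> assume \<zeta>: "\<zeta> \<in> N"
      then have "0 < cmod (g \<zeta> - h \<zeta>)" by (simp add: N_def)
      then obtain k where "1 / real (Suc k) < cmod (g \<zeta> - h \<zeta>)"
        using reals_Archimedean[of "cmod (g \<zeta> - h \<zeta>)"] by (auto simp: inverse_eq_divide)
      then show "\<zeta> \<in> (\<Union>k. ?E k)" using \<zeta> by (auto simp: N_def intro!: exI[of _ k])
    qed
    ultimately show ?thesis by (rule cap_small_mono)
  qed
  ultimately show ?thesis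
    using outer_cap_0I by (intro bexI[of _ N]) (auto simp: N_def)
qed

text \<open>The capacity analogue of the Riesz subsequence theorem: radii are chosen so fast that
  the sets of large increments have summable sizes, as in the Borel-Cantelli lemma.\<close>

lemma radial_limit_in_capacity:
  assumes f: "f \<in> H"
  obtains fstar and r :: "nat \<Rightarrow> real" and N
  where "fstar \<in> borel_measurable sphere_borel" "converges_in_cap K f fstar"
    "\<And>n. 0 \<le> r n" "\<And>n. r n < 1" "r \<longlonglongrightarrow> 1" "N \<in> sets sphere_borel" "outer_cap K N = 0"
    "\<And>\<zeta>. \<zeta> \<in> sphere 0 1 - N \<Longrightarrow> (\<lambda>n. f (r n *\<^sub>R \<zeta>)) \<longlonglongrightarrow> fstar \<zeta>"
proof -
  have "\<forall>n. \<exists>a. 0 \<le> a \<and> a < 1 \<and> (\<forall>r s. a < r \<longrightarrow> r < 1 \<longrightarrow> a < s \<longrightarrow> s < 1 \<longrightarrow>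
      cap_small {\<zeta> \<in> sphere 0 1. (1 / 2) ^ n \<le> cmod (f (r *\<^sub>R \<zeta>) - f (s *\<^sub>R \<zeta>))} ((1 / 2) ^ n))"
  proof
    fix n :: nat
    have p: "0 < (1 / 2 :: real) ^ n" by simp
    show "\<exists>a. 0 \<le> a \<and> a < 1 \<and> (\<forall>r s. a < r \<longrightarrow> r < 1 \<longrightarrow> a < s \<longrightarrow> s < 1 \<longrightarrow>
      cap_small {\<zeta> \<in> sphere 0 1. (1 / 2) ^ n \<le> cmod (f (r *\<^sub>R \<zeta>) - f (s *\<^sub>R \<zeta>))} ((1 / 2) ^ n))"
      by (rule radial_Cauchy_in_capacity[OF f p p]) blast
  qed
  from choice[OF this] obtain a where a: "\<And>n. 0 \<le> a n" "\<And>n. a n < 1"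
    and cap: "\<And>n r s. a n < r \<Longrightarrow> r < 1 \<Longrightarrow> a n < s \<Longrightarrow> s < 1 \<Longrightarrow>
      cap_small {\<zeta> \<in> sphere 0 1. (1 / 2) ^ n \<le> cmod (f (r *\<^sub>R \<zeta>) - f (s *\<^sub>R \<zeta>))} ((1 / 2) ^ n)"
    by blast
  \<comment> \<open>The thresholds \<open>a\<close> need not increase. With the running maximum,
    both \<open>r n\<close> and \<open>r (Suc n)\<close> exceed \<open>a n\<close>; the second term
    in \<open>r\<close> forces convergence to 1.\<close>
  define b where "b n = Max (a ` {..n})" for n
  have b: "b n < 1" for n using a(2) by (simp add: b_def)
  have ab: "a m \<le> b n" if "m \<le> n" for m n
    unfolding b_def using that by (intro Max_ge) auto
  define r where "r n = max ((1 + b n) / 2) (1 - inverse (real (Suc n)))" for n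
  have r1: "r n < 1" for n using b[of n] by (simp add: r_def)
  have ar: "a m < r n" if "m \<le> n" for m n
    using ab[OF that] b[of n] by (simp add: r_def less_max_iff_disj)
  have r0: "0 \<le> r n" for n using a(1)[of n] ar[of n n] by simp
  have rlim: "r \<longlonglongrightarrow> 1"
  proof (rule tendsto_sandwich[of "\<lambda>n. 1 - inverse (real (Suc n))" _ _ "\<lambda>_. 1"])
    show "(\<lambda>n. 1 - inverse (real (Suc n))) \<longlonglongrightarrow> 1"
      using tendsto_diff[OF tendsto_const LIMSEQ_inverse_real_of_nat, of 1] by simp
  qed (use r1 in \<open>auto simp: r_def intro!: always_eventually less_imp_le\<close>)
  have cont: "continuous_on (sphere 0 1) (\<lambda>\<zeta>. f (r n *\<^sub>R \<zeta>))" for n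
    by (rule continuous_on_scaled[OF f r0 r1])
  have meas [measurable]: "(\<lambda>\<zeta>. f (r n *\<^sub>R \<zeta>)) \<in> borel_measurable sphere_borel" for n
    by (rule borel_measurable_sphere[OF cont])
  \<comment> \<open>At points of divergence \<open>lim\<close> returns one fixed unspecified value,
    so \<open>fstar\<close> is Borel on the whole sphere. Such points lie in every
    \<open>T m\<close>.\<close>
  define fstar where "fstar \<zeta> = lim (\<lambda>n. f (r n *\<^sub>R \<zeta>))" for \<zeta>
  have fstar: "fstar \<in> borel_measurable sphere_borel"
    unfolding fstar_def by measurable
  define E where "E n = {\<zeta> \<in> space sphere_borel. (1 / 2) ^ n \<le> cmod (f (r n *\<^sub>R \<zeta>) - f (r (Suc n) *\<^sub>R \<zeta>))}" for n
  have E: "E n \<in> sets sphere_borel" for n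
    unfolding E_def by measurable
  have capE: "cap_small (E n) ((1 / 2) ^ n)" for n
    using cap[OF ar[of n n] r1 ar[of n "Suc n"] r1] by (simp add: E_def)
  define T where "T m = (\<Union>n. E (n + m))" for m
  have capT: "cap_small (T m) (2 * (1 / 2) ^ m)" for m
  proof -
    have s: "(\<lambda>n. (1 / 2 :: real) ^ (n + m)) sums (2 * (1 / 2) ^ m)"
      using sums_mult2[OF geometric_sums[of "1 / 2 :: real"], of "(1 / 2) ^ m"] by (simp add: power_add)
    then show ?thesis
      unfolding T_def using cap_small_UN[OF capE sums_summable[OF s]] sums_unique[OF s] by simp
  qed
  have off: "convergent (\<lambda>n. f (r n *\<^sub>R \<zeta>))" "cmod (fstar \<zeta> - f (r m *\<^sub>R \<zeta>)) \<le> 2 * (1 / 2) ^ m"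
    if \<zeta>: "\<zeta> \<in> sphere 0 1" "\<zeta> \<notin> T m" for \<zeta> m
  proof -
    have "cmod (f (r n *\<^sub>R \<zeta>) - f (r (Suc n) *\<^sub>R \<zeta>)) \<le> (1 / 2) ^ n" if "m \<le> n" for n
    proof -
      have "\<zeta> \<notin> E (n - m + m)" using \<zeta>(2) unfolding T_def by blast
      then show ?thesis using that \<zeta>(1) by (simp add: E_def)
    qed
    note * = geometric_Cauchy_limit[of m "\<lambda>n. f (r n *\<^sub>R \<zeta>)", OF this]
    show "convergent (\<lambda>n. f (r n *\<^sub>R \<zeta>))" using * by simp
    show "cmod (fstar \<zeta> - f (r m *\<^sub>R \<zeta>)) \<le> 2 * (1 / 2) ^ m" using * by (simp add: fstar_def)
  qed
  have half0: "(\<lambda>m. 2 * (1 / 2 :: real) ^ m) \<longlonglongrightarrow> 0"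
    by (intro tendsto_mult_right_zero LIMSEQ_power_zero) simp
  define N where "N = (\<Inter>m. T m)"
  have N: "N \<in> sets sphere_borel"
    unfolding N_def T_def using E by (intro sets.countable_INT) auto
  have N0: "outer_cap K N = 0"
  proof (rule outer_cap_0I)
    fix \<delta> :: real assume "0 < \<delta>"
    then have "\<forall>\<^sub>F m in sequentially. 2 * (1 / 2) ^ m < \<delta>"
      using order_tendstoD(2)[OF half0] by blast
    then obtain m where "2 * (1 / 2) ^ m < \<delta>"
      using eventually_happens'[OF sequentially_bot] by blast
    then have "cap_small (T m) \<delta>"
      using cap_small_increasing[OF capT] by simp
    then show "cap_small N \<delta>"
      by (rule cap_small_mono) (auto simp: N_def)
  qed
  have pointwise: "(\<lambda>n. f (r n *\<^sub>R \<zeta>)) \<longlonglongrightarrow> fstar \<zeta>" if \<zeta>: "\<zeta> \<in> sphere 0 1 - N" for \<zeta>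
  proof -
    obtain m where "\<zeta> \<notin> T m" using \<zeta> unfolding N_def by blast
    then show ?thesis
      using off(1)[of \<zeta> m] \<zeta> unfolding fstar_def by (simp add: convergent_LIMSEQ_iff)
  qed
  \<comment> \<open>From the sequence to all radii: one index \<open>m\<close> is fixed with
    \<open>fstar\<close> close to the dilate at \<open>r m\<close> off \<open>T m\<close>, and the
    Cauchy property compares that dilate with the one at every \<open>s\<close> near 1.\<close>
  have conv: "converges_in_cap K f fstar"
    unfolding converges_in_cap_iff
  proof (intro allI impI)
    fix \<epsilon> \<delta> :: real assume pos: "0 < \<epsilon>" "0 < \<delta>"
    obtain c where c: "0 \<le> c" "c < 1" and Cauchy: "\<And>r s. c < r \<Longrightarrow> r < 1 \<Longrightarrow> c < s \<Longrightarrow> s < 1 \<Longrightarrow>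
        cap_small {\<zeta> \<in> sphere 0 1. \<epsilon> / 2 \<le> cmod (f (r *\<^sub>R \<zeta>) - f (s *\<^sub>R \<zeta>))} (\<delta> / 2)"
      by (rule radial_Cauchy_in_capacity[OF f, of "\<epsilon> / 2" "\<delta> / 2"])
        (use pos that in auto)
    have "\<forall>\<^sub>F m in sequentially. c < r m \<and> 2 * (1 / 2) ^ m < min (\<epsilon> / 2) (\<delta> / 2)"
      using order_tendstoD(1)[OF rlim c(2)] order_tendstoD(2)[OF half0, of "min (\<epsilon> / 2) (\<delta> / 2)"] pos
      by (intro eventually_conj) auto
    from eventually_happens'[OF sequentially_bot this] obtain m where
      m: "c < r m" "2 * (1 / 2) ^ m < \<epsilon> / 2" "2 * (1 / 2) ^ m < \<delta> / 2" by auto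
    have "cap_small {\<zeta> \<in> sphere 0 1. \<epsilon> \<le> cmod (fstar \<zeta> - f (s *\<^sub>R \<zeta>))} \<delta>"
      if s: "c < s" "s < 1" for s
    proof -
      have "cap_small (T m) (\<delta> / 2)"
        using cap_small_increasing[OF capT] m(3) by simp
      from cap_small_Un[OF this Cauchy[OF m(1) r1 s]]
      have "cap_small (T m \<union> {\<zeta> \<in> sphere 0 1. \<epsilon> / 2 \<le> cmod (f (r m *\<^sub>R \<zeta>) - f (s *\<^sub>R \<zeta>))}) \<delta>"
        by simp
      moreover have "{\<zeta> \<in> sphere 0 1. \<epsilon> \<le> cmod (fstar \<zeta> - f (s *\<^sub>R \<zeta>))} \<subseteq>
          T m \<union> {\<zeta> \<in> sphere 0 1. \<epsilon> / 2 \<le> cmod (f (r m *\<^sub>R \<zeta>) - f (s *\<^sub>R \<zeta>))}"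
      proof
        fix \<zeta> assume \<zeta>: "\<zeta> \<in> {\<zeta> \<in> sphere 0 1. \<epsilon> \<le> cmod (fstar \<zeta> - f (s *\<^sub>R \<zeta>))}"
        show "\<zeta> \<in> T m \<union> {\<zeta> \<in> sphere 0 1. \<epsilon> / 2 \<le> cmod (f (r m *\<^sub>R \<zeta>) - f (s *\<^sub>R \<zeta>))}"
        proof (cases "\<zeta> \<in> T m")
          case False
          then have "cmod (fstar \<zeta> - f (r m *\<^sub>R \<zeta>)) < \<epsilon> / 2"
            using off(2)[of \<zeta> m] \<zeta> m(2) by simp
          then show ?thesis
            using \<zeta> norm_triangle_ineq[of "fstar \<zeta> - f (r m *\<^sub>R \<zeta>)" "f (r m *\<^sub>R \<zeta>) - f (s *\<^sub>R \<zeta>)"]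
            by simp
        qed simp
      qed
      ultimately show ?thesis by (rule cap_small_mono)
    qed
    then show "\<forall>\<^sub>F s in at_left 1. cap_small {\<zeta> \<in> sphere 0 1. \<epsilon> \<le> cmod (fstar \<zeta> - f (s *\<^sub>R \<zeta>))} \<delta>"
      unfolding eventually_at_left_field using c(2) by blast
  qed
  show thesis
    by (rule that[OF fstar conv r0 r1 rlim N N0 pointwise])
qed

end

theorem theorem5p2:
  fixes H :: "(complex ^ 'd \<Rightarrow> complex) set"
    and ip :: "(complex ^ 'd \<Rightarrow> complex) \<Rightarrow> (complex ^ 'd \<Rightarrow> complex) \<Rightarrow> complex"
    and K :: "complex ^ 'd \<Rightarrow> complex ^ 'd \<Rightarrow> complex"
    and f :: "complex ^ 'd \<Rightarrow> complex"
  assumes "unitarily_invariant_space H ip K"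
    and "\<And>z w. z \<in> ball 0 1 \<Longrightarrow> w \<in> ball 0 1 \<Longrightarrow> 0 \<le> Re (K z w)"
    and "f \<in> H"
  shows "\<exists>fstar \<in> borel_measurable sphere_borel.
      converges_in_cap K f fstar \<and>
      (\<forall>g \<in> borel_measurable sphere_borel.
         converges_in_cap K f g \<longrightarrow>
         (\<exists>N \<in> sets sphere_borel. outer_cap K N = 0 \<and>
            (\<forall>\<zeta> \<in> sphere 0 1 - N. g \<zeta> = fstar \<zeta>))) \<and>
      (\<exists>r :: nat \<Rightarrow> real. (\<forall>n. 0 \<le> r n \<and> r n < 1) \<and> r \<longlonglongrightarrow> 1 \<and>
         (\<exists>N \<in> sets sphere_borel. outer_cap K N = 0 \<and>
            (\<forall>\<zeta> \<in> sphere 0 1 - N. (\<lambda>n. f (r n *\<^sub>R \<zeta>)) \<longlonglongrightarrow> fstar \<zeta>)))"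
proof -
  interpret nonneg_kernel_space H ip K
    using assms(1,2) by (simp add: nonneg_kernel_space_def nonneg_kernel_space_axioms_def)
  obtain fstar and r :: "nat \<Rightarrow> real" and N
    where fstar: "fstar \<in> borel_measurable sphere_borel" "converges_in_cap K f fstar"
      and r: "\<And>n. 0 \<le> r n" "\<And>n. r n < 1" "r \<longlonglongrightarrow> 1"
      and N: "N \<in> sets sphere_borel" "outer_cap K N = 0"
        "\<And>\<zeta>. \<zeta> \<in> sphere 0 1 - N \<Longrightarrow> (\<lambda>n. f (r n *\<^sub>R \<zeta>)) \<longlonglongrightarrow> fstar \<zeta>"
    by (rule radial_limit_in_capacity[OF assms(3)]) (rule that)
  have seq: "\<exists>r :: nat \<Rightarrow> real. (\<forall>n. 0 \<le> r n \<and> r n < 1) \<and> r \<longlonglongrightarrow> 1 \<and>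
         (\<exists>N \<in> sets sphere_borel. outer_cap K N = 0 \<and>
            (\<forall>\<zeta> \<in> sphere 0 1 - N. (\<lambda>n. f (r n *\<^sub>R \<zeta>)) \<longlonglongrightarrow> fstar \<zeta>))"
    using r N by blast
  show ?thesis
    using fstar seq converges_in_cap_unique[OF _ fstar(2) _ fstar(1)]
    by (intro bexI[of _ fstar] conjI ballI impI) auto
qed

end
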